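(* The skew monoidal category freely generated by a single object admits a unique faithful structure-preserving functor into the skew monoidal category $\mathbf{\Delta}_\bot$ which sends the generating object to the unit of $\mathbf{\Delta}_\bot$.
   Context: **Skew monoidal categories.** A (left) skew monoidal category is a category $\mathcal C$ with an object $I$, a functor $\otimes\colon\mathcal C\times\mathcal C\to\mathcal C$, and natural families (not necessarily invertible) $\alpha_{X,Y,Z}\colon (X\otimes Y)\otimes Z\to X\otimes(Y\otimes Z)$, $\lambda_X\colon I\otimes X\to X$, $\rho_X\colon X\to X\otimes I$ such that (1) $(1_W\otimes\alpha_{X,Y,Z})\circ\alpha_{W,X\otimes Y,Z}\circ(\alpha_{W,X,Y}\otimes 1_Z)=\alpha_{W,X,Y\otimes Z}\circ\alpha_{W\otimes X,Y,Z}$; (2) $\lambda_{X\otimes Y}\circ\alpha_{I,X,Y}=\lambda_X\otimes 1_Y$; (3) $(1_X\otimes\lambda_Y)\circ\alpha_{X,I,Y}\circ(\rho_X\otimes 1_Y)=1_{X\otimes Y}$; (4) $\alpha_{X,Y,I}\circ\rho_{X\otimes Y}=1_X\otimes\rho_Y$; (5) $\lambda_I\circ\rho_I=1_I$. "Structure-preserving" means strictly preserving tensor, unit, $\alpha$, $\lambda$, $\rho$. **Free skew monoidal category on one object.** A skew monoidal category $\mathbf{Fsk}$ with a chosen object $X$ such that for every skew monoidal category $\mathcal C$ and object $C$ of $\mathcal C$ there is a unique structure-preserving functor $F\colon\mathbf{Fsk}\to\mathcal C$ with $F(X)=C$. It is determined up to isomorphism. **The skew monoidal category $\mathbf{\Delta}_\bot$.**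 Objects are the non-empty finite ordinals $\mathbf n=\{0,\dots,n-1\}$, $n\ge1$; morphisms are the order-preserving functions preserving the first element $0$. The tensor product is ordinal sum: $\mathbf m\otimes\mathbf n=\mathbf{m+n}$, and for $\xi\colon\mathbf m\to\mathbf m'$, $\zeta\colon\mathbf n\to\mathbf n'$, $(\xi\otimes\zeta)(i)=\xi(i)$ for $i<m$ and $(\xi\otimes\zeta)(m+j)=m'+\zeta(j)$. The unit is $\mathbf 1$. The associativity constraint $\alpha$ is the identity; $\lambda_{\mathbf n}\colon\mathbf{1+n}\to\mathbf n$ is the order-preserving surjection identifying $0$ and $1$; $\rho_{\mathbf n}\colon\mathbf n\to\mathbf{n+1}$ is the order-preserving injection whose image omits $n$. *)

theory Defs
  imports "HOL-Library.FuncSet" "HOL-Library.Infinite_Typeclass"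
begin

section \<open>Skew monoidal categories\<close>

text \<open>Categories are small, with a carrier set of objects and a carrier set of arrows;
  \<open>g \<cdot> f\<close> is the composite "first \<open>f\<close>, then \<open>g\<close>".\<close>

record ('o, 'a) category =
  Obj :: "'o set"
  Arr :: "'a set"
  Dom :: "'a \<Rightarrow> 'o"
  Cod :: "'a \<Rightarrow> 'o"
  Ident :: "'o \<Rightarrow> 'a"
  Comp :: "'a \<Rightarrow> 'a \<Rightarrow> 'a"  (infixr "\<cdot>\<index>" 60)

definition hom :: "('o, 'a, 'm) category_scheme \<Rightarrow> 'o \<Rightarrow> 'o \<Rightarrow> 'a set" where
  "hom C A B = {f \<in> Arr C. Dom C f = A \<and> Cod C f = B}"

locale category =
  fixes C :: "('o, 'a, 'm) category_scheme" (structure)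
  assumes Dom_Obj: "f \<in> Arr C \<Longrightarrow> Dom C f \<in> Obj C"
    and Cod_Obj: "f \<in> Arr C \<Longrightarrow> Cod C f \<in> Obj C"
    and Ident_hom: "A \<in> Obj C \<Longrightarrow> Ident C A \<in> hom C A A"
    and Comp_hom: "f \<in> hom C A B \<Longrightarrow> g \<in> hom C B D \<Longrightarrow> g \<cdot> f \<in> hom C A D"
    and Comp_Ident: "f \<in> hom C A B \<Longrightarrow> f \<cdot> Ident C A = f"
    and Ident_Comp: "f \<in> hom C A B \<Longrightarrow> Ident C B \<cdot> f = f"
    and Comp_assoc: "f \<in> hom C A B \<Longrightarrow> g \<in> hom C B D \<Longrightarrow> h \<in> hom C D E
      \<Longrightarrow> (h \<cdot> g) \<cdot> f = h \<cdot> (g \<cdot> f)"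

record ('o, 'a) skew_monoidal = "('o, 'a) category" +
  TensorO :: "'o \<Rightarrow> 'o \<Rightarrow> 'o"  (infixr "\<otimes>\<index>" 70)
  TensorA :: "'a \<Rightarrow> 'a \<Rightarrow> 'a"  (infixr "\<boxtimes>\<index>" 70)
  Unit :: "'o"
  Assoc :: "'o \<Rightarrow> 'o \<Rightarrow> 'o \<Rightarrow> 'a"
  LUnit :: "'o \<Rightarrow> 'a"
  RUnit :: "'o \<Rightarrow> 'a"

locale skew_monoidal_category = category C
  for C :: "('o, 'a, 'm) skew_monoidal_scheme" (structure) +
  assumes Unit_Obj: "Unit C \<in> Obj C"
    and TensorO_Obj: "A \<in> Obj C \<Longrightarrow> B \<in> Obj C \<Longrightarrow> A \<otimes> B \<in> Obj C"
    and TensorA_hom: "f \<in> hom C A A' \<Longrightarrow> g \<in> hom C B B'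
      \<Longrightarrow> f \<boxtimes> g \<in> hom C (A \<otimes> B) (A' \<otimes> B')"
    and TensorA_Ident: "A \<in> Obj C \<Longrightarrow> B \<in> Obj C
      \<Longrightarrow> Ident C A \<boxtimes> Ident C B = Ident C (A \<otimes> B)"
    and TensorA_Comp: "f \<in> hom C A A' \<Longrightarrow> f' \<in> hom C A' A'' \<Longrightarrow> g \<in> hom C B B' \<Longrightarrow> g' \<in> hom C B' B''
      \<Longrightarrow> (f' \<cdot> f) \<boxtimes> (g' \<cdot> g) = (f' \<boxtimes> g') \<cdot> (f \<boxtimes> g)"
    and Assoc_hom: "X \<in> Obj C \<Longrightarrow> Y \<in> Obj C \<Longrightarrow> Z \<in> Obj C
      \<Longrightarrow> Assoc C X Y Z \<in> hom C ((X \<otimes> Y) \<otimes> Z) (X \<otimes> (Y \<otimes> Z))"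
    and LUnit_hom: "X \<in> Obj C \<Longrightarrow> LUnit C X \<in> hom C (Unit C \<otimes> X) X"
    and RUnit_hom: "X \<in> Obj C \<Longrightarrow> RUnit C X \<in> hom C X (X \<otimes> Unit C)"
    and Assoc_natural: "f \<in> hom C X X' \<Longrightarrow> g \<in> hom C Y Y' \<Longrightarrow> h \<in> hom C Z Z'
      \<Longrightarrow> Assoc C X' Y' Z' \<cdot> ((f \<boxtimes> g) \<boxtimes> h) = (f \<boxtimes> (g \<boxtimes> h)) \<cdot> Assoc C X Y Z"
    and LUnit_natural: "f \<in> hom C X X'
      \<Longrightarrow> LUnit C X' \<cdot> (Ident C (Unit C) \<boxtimes> f) = f \<cdot> LUnit C X"
    and RUnit_natural: "f \<in> hom C X X'
      \<Longrightarrow> RUnit C X' \<cdot> f = (f \<boxtimes> Ident C (Unit C)) \<cdot> RUnit C X"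
    and pentagon: "W \<in> Obj C \<Longrightarrow> X \<in> Obj C \<Longrightarrow> Y \<in> Obj C \<Longrightarrow> Z \<in> Obj C
      \<Longrightarrow> (Ident C W \<boxtimes> Assoc C X Y Z) \<cdot> Assoc C W (X \<otimes> Y) Z \<cdot> (Assoc C W X Y \<boxtimes> Ident C Z)
        = Assoc C W X (Y \<otimes> Z) \<cdot> Assoc C (W \<otimes> X) Y Z"
    and LUnit_Assoc: "X \<in> Obj C \<Longrightarrow> Y \<in> Obj C
      \<Longrightarrow> LUnit C (X \<otimes> Y) \<cdot> Assoc C (Unit C) X Y = LUnit C X \<boxtimes> Ident C Y"
    and LUnit_Assoc_RUnit: "X \<in> Obj C \<Longrightarrow> Y \<in> Obj C
      \<Longrightarrow> (Ident C X \<boxtimes> LUnit C Y) \<cdot> Assoc C X (Unit C) Y \<cdot> (RUnit C X \<boxtimes> Ident C Y)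
        = Ident C (X \<otimes> Y)"
    and Assoc_RUnit: "X \<in> Obj C \<Longrightarrow> Y \<in> Obj C
      \<Longrightarrow> Assoc C X Y (Unit C) \<cdot> RUnit C (X \<otimes> Y) = Ident C X \<boxtimes> RUnit C Y"
    and LUnit_RUnit: "LUnit C (Unit C) \<cdot> RUnit C (Unit C) = Ident C (Unit C)"


section \<open>Structure-preserving functors\<close>

text \<open>A functor is a pair of an object map and an arrow map.  Both are required to be
  \<open>undefined\<close> off the carriers (\<open>\<rightarrow>\<^sub>E\<close>), so that equality of such pairs is equality of functors.\<close>

locale structure_preserving_functor =
  fixes C :: "('o, 'a) skew_monoidal" and D :: "('p, 'b) skew_monoidal"
    and P :: "('o \<Rightarrow> 'p) \<times> ('a \<Rightarrow> 'b)"
  assumes obj_map: "fst P \<in> Obj C \<rightarrow>\<^sub>E Obj D"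
    and arr_map: "snd P \<in> Arr C \<rightarrow>\<^sub>E Arr D"
    and map_Dom: "f \<in> Arr C \<Longrightarrow> Dom D (snd P f) = fst P (Dom C f)"
    and map_Cod: "f \<in> Arr C \<Longrightarrow> Cod D (snd P f) = fst P (Cod C f)"
    and map_Ident: "A \<in> Obj C \<Longrightarrow> snd P (Ident C A) = Ident D (fst P A)"
    and map_Comp: "f \<in> Arr C \<Longrightarrow> g \<in> Arr C \<Longrightarrow> Dom C g = Cod C f
      \<Longrightarrow> snd P (g \<cdot>\<^bsub>C\<^esub> f) = snd P g \<cdot>\<^bsub>D\<^esub> snd P f"
    and map_Unit: "fst P (Unit C) = Unit D"
    and map_TensorO: "A \<in> Obj C \<Longrightarrow> B \<in> Obj C
      \<Longrightarrow> fst P (A \<otimes>\<^bsub>C\<^esub> B) = fst P A \<otimes>\<^bsub>D\<^esub> fst P B"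
    and map_TensorA: "f \<in> Arr C \<Longrightarrow> g \<in> Arr C
      \<Longrightarrow> snd P (f \<boxtimes>\<^bsub>C\<^esub> g) = snd P f \<boxtimes>\<^bsub>D\<^esub> snd P g"
    and map_Assoc: "A \<in> Obj C \<Longrightarrow> B \<in> Obj C \<Longrightarrow> E \<in> Obj C
      \<Longrightarrow> snd P (Assoc C A B E) = Assoc D (fst P A) (fst P B) (fst P E)"
    and map_LUnit: "A \<in> Obj C \<Longrightarrow> snd P (LUnit C A) = LUnit D (fst P A)"
    and map_RUnit: "A \<in> Obj C \<Longrightarrow> snd P (RUnit C A) = RUnit D (fst P A)"

definition faithful ::
  "('o, 'a) skew_monoidal \<Rightarrow> ('o \<Rightarrow> 'p) \<times> ('a \<Rightarrow> 'b) \<Rightarrow> bool" where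
  "faithful C P \<longleftrightarrow> (\<forall>A\<in>Obj C. \<forall>B\<in>Obj C. inj_on (snd P) (hom C A B))"


section \<open>The free skew monoidal category on one object\<close>

text \<open>A formula cannot quantify over types, so the universal property is stated against
  all skew monoidal categories \<open>C\<close> carried by the types \<open>'o\<close> and \<open>'a\<close> that also carry \<open>F\<close>.
  These play the role of a universe, and they are required to be infinite.  Nothing is lost:
  the terms for objects and arrows built from one generator form a countable set, so the
  syntactic free skew monoidal category has an isomorphic copy on any two infinite types, that
  copy is one of the test categories \<open>C\<close>, and hence \<open>F\<close> is isomorphic to it and has the universal
  property against skew monoidal categories on arbitrary types.  Conversely a free \<open>F\<close> has
  infinitely many objects, hence infinitely many arrows, so that its types must be infinite.
  Over finite types the property would be wrong; e.g. the terminal category on the type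
  \<open>unit\<close> would have it.\<close>

definition free_skew_monoidal_on_object ::
  "('o::infinite, 'a::infinite) skew_monoidal \<Rightarrow> 'o \<Rightarrow> bool" where
  "free_skew_monoidal_on_object F X \<longleftrightarrow>
     skew_monoidal_category F \<and> X \<in> Obj F \<and>
     (\<forall>(C :: ('o, 'a) skew_monoidal) c. skew_monoidal_category C \<longrightarrow> c \<in> Obj C \<longrightarrow>
        (\<exists>!P. structure_preserving_functor F C P \<and> fst P X = c))"


section \<open>The skew monoidal category \<open>\<Delta>\<^sub>\<bottom>\<close>\<close>

text \<open>The ordinal \<open>\<^bold>n\<close> is represented by the number \<open>n\<close>, with elements \<open>{..<n}\<close>.  An arrow is a
  triple \<open>(m, n, \<xi>)\<close> of domain, codomain and underlying function, the latter being
  \<open>undefined\<close> outside \<open>{..<m}\<close>.\<close>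

definition Delta_bot :: "(nat, nat \<times> nat \<times> (nat \<Rightarrow> nat)) skew_monoidal" where
  "Delta_bot = \<lparr>
     Obj = {n. 1 \<le> n},
     Arr = {(m, n, \<xi>). 1 \<le> m \<and> 1 \<le> n \<and> \<xi> \<in> {..<m} \<rightarrow>\<^sub>E {..<n} \<and> mono_on {..<m} \<xi> \<and> \<xi> 0 = 0},
     Dom = (\<lambda>(m, n, \<xi>). m),
     Cod = (\<lambda>(m, n, \<xi>). n),
     Ident = (\<lambda>n. (n, n, \<lambda>i\<in>{..<n}. i)),
     Comp = (\<lambda>(m', n', \<zeta>) (m, n, \<xi>). (m, n', compose {..<m} \<zeta> \<xi>)),
     TensorO = (\<lambda>m n. m + n),
     TensorA = (\<lambda>(m, m', \<xi>) (n, n', \<zeta>).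
       (m + n, m' + n', \<lambda>i\<in>{..<m + n}. if i < m then \<xi> i else m' + \<zeta> (i - m))),
     Unit = 1,
     Assoc = (\<lambda>m n p. (m + n + p, m + n + p, \<lambda>i\<in>{..<m + n + p}. i)),
     LUnit = (\<lambda>n. (1 + n, n, \<lambda>i\<in>{..<1 + n}. if i = 0 then 0 else i - 1)),
     RUnit = (\<lambda>n. (n, n + 1, \<lambda>i\<in>{..<n}. i)) \<rparr>"

lemma hom_Delta_bot_iff:
  "a \<in> hom Delta_bot m n \<longleftrightarrow> (\<exists>\<xi>. a = (m, n, \<xi>) \<and> 1 \<le> m \<and> 1 \<le> n \<and>
     \<xi> \<in> {..<m} \<rightarrow>\<^sub>E {..<n} \<and> mono_on {..<m} \<xi> \<and> \<xi> 0 = 0)"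
  by (auto simp: hom_def Delta_bot_def)

lemma triple_hom_Delta_bot_iff:
  "(m', n', \<xi>) \<in> hom Delta_bot m n \<longleftrightarrow> m' = m \<and> n' = n \<and> 1 \<le> m \<and> 1 \<le> n \<and>
     \<xi> \<in> {..<m} \<rightarrow>\<^sub>E {..<n} \<and> mono_on {..<m} \<xi> \<and> \<xi> 0 = 0"
  by (auto simp: hom_Delta_bot_iff)

lemma Delta_bot_sel:
  "Obj Delta_bot = {n. 1 \<le> n}"
  "Dom Delta_bot (m, n, \<xi>) = m"
  "Cod Delta_bot (m, n, \<xi>) = n"
  "Ident Delta_bot n = (n, n, \<lambda>i\<in>{..<n}. i)"
  "Comp Delta_bot (m', n', \<zeta>) (m, n, \<xi>) = (m, n', compose {..<m} \<zeta> \<xi>)"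
  "TensorO Delta_bot m n = m + n"
  "TensorA Delta_bot (m, m', \<xi>) (n, n', \<zeta>) =
     (m + n, m' + n', \<lambda>i\<in>{..<m + n}. if i < m then \<xi> i else m' + \<zeta> (i - m))"
  "Unit Delta_bot = 1"
  "Assoc Delta_bot m n p = (m + n + p, m + n + p, \<lambda>i\<in>{..<m + n + p}. i)"
  "LUnit Delta_bot n = (1 + n, n, \<lambda>i\<in>{..<1 + n}. if i = 0 then 0 else i - 1)"
  "RUnit Delta_bot n = (n, n + 1, \<lambda>i\<in>{..<n}. i)"
  by (simp_all add: Delta_bot_def)

lemma PiE_lt: "\<xi> \<in> {..<m} \<rightarrow>\<^sub>E {..<n} \<Longrightarrow> i < m \<Longrightarrow> \<xi> i < (n::nat)" for m :: nat
  by (auto simp: PiE_def Pi_def)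

lemma PiE_undef: "\<xi> \<in> {..<m} \<rightarrow>\<^sub>E B \<Longrightarrow> \<not> i < m \<Longrightarrow> \<xi> i = undefined" for m :: nat
  by (auto simp: PiE_def extensional_def)

lemma skew_monoidal_category_Delta_bot: "skew_monoidal_category Delta_bot"
proof unfold_locales
  fix f assume "f \<in> Arr Delta_bot"
  then show "Dom Delta_bot f \<in> Obj Delta_bot" "Cod Delta_bot f \<in> Obj Delta_bot"
    by (auto simp: Delta_bot_def)
next
  fix f A A' g B B' assume "f \<in> hom Delta_bot A A'" "g \<in> hom Delta_bot B B'"
  then show "f \<boxtimes>\<^bsub>Delta_bot\<^esub> g \<in> hom Delta_bot (A \<otimes>\<^bsub>Delta_bot\<^esub> B) (A' \<otimes>\<^bsub>Delta_bot\<^esub> B')"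
  proof (clarsimp simp: hom_Delta_bot_iff Delta_bot_sel)
    fix \<xi> \<zeta>
    assume *: "\<xi> \<in> {..<A} \<rightarrow>\<^sub>E {..<A'}" "\<zeta> \<in> {..<B} \<rightarrow>\<^sub>E {..<B'}"
      "mono_on {..<A} \<xi>" "mono_on {..<B} \<zeta>"
    have 1: "\<zeta> (i - A) < B'" if "i < A + B" "\<not> i < A" for i
      using PiE_lt[OF *(2), of "i - A"] that by linarith
    have 2: "\<xi> i \<le> A' + k" if "i < A" for i k
      using PiE_lt[OF *(1) that] by linarith
    have 3: "\<zeta> (i - A) \<le> \<zeta> (j - A)" if "i \<le> j" "\<not> i < A" "j < A + B" for i j
      by (rule mono_onD[OF *(4)]) (use that in auto)
    show "(\<lambda>i. if i < A then \<xi> i else A' + \<zeta> (i - A)) \<in> {..<A + B} \<rightarrow> {..<A' + B'} \<and>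
        mono_on {..<A + B} (\<lambda>i\<in>{..<A + B}. if i < A then \<xi> i else A' + \<zeta> (i - A))"
      using 1 2 3 PiE_lt[OF *(1)] mono_onD[OF *(3)]
      by (auto simp: mono_on_def trans_less_add1)
  qed
next
  fix f A B assume "f \<in> hom Delta_bot A B"
  then obtain \<xi> where f: "f = (A, B, \<xi>)" and \<xi>: "\<xi> \<in> {..<A} \<rightarrow>\<^sub>E {..<B}"
    by (auto simp: hom_Delta_bot_iff)
  note lt = PiE_lt[OF \<xi>] and undef = PiE_undef[OF \<xi>]
  show "f \<cdot>\<^bsub>Delta_bot\<^esub> Ident Delta_bot A = f" "Ident Delta_bot B \<cdot>\<^bsub>Delta_bot\<^esub> f = f"
    using lt undef by (auto simp: f Delta_bot_sel compose_def fun_eq_iff)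
  show "LUnit Delta_bot B \<cdot>\<^bsub>Delta_bot\<^esub> (Ident Delta_bot (Unit Delta_bot) \<boxtimes>\<^bsub>Delta_bot\<^esub> f)
      = f \<cdot>\<^bsub>Delta_bot\<^esub> LUnit Delta_bot A"
    using lt \<open>f \<in> _\<close> by (auto simp: f hom_Delta_bot_iff Delta_bot_sel compose_def fun_eq_iff)
  show "RUnit Delta_bot B \<cdot>\<^bsub>Delta_bot\<^esub> f
      = (f \<boxtimes>\<^bsub>Delta_bot\<^esub> Ident Delta_bot (Unit Delta_bot)) \<cdot>\<^bsub>Delta_bot\<^esub> RUnit Delta_bot A"
    using lt by (auto simp: f Delta_bot_sel compose_def fun_eq_iff)
next
  fix f A B g D assume "f \<in> hom Delta_bot A B" "g \<in> hom Delta_bot B D"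
  then show "g \<cdot>\<^bsub>Delta_bot\<^esub> f \<in> hom Delta_bot A D"
    by (fastforce simp: hom_Delta_bot_iff Delta_bot_sel compose_def mono_on_def PiE_iff)
  fix h E assume "h \<in> hom Delta_bot D E"
  with \<open>f \<in> _\<close> \<open>g \<in> _\<close> show "(h \<cdot>\<^bsub>Delta_bot\<^esub> g) \<cdot>\<^bsub>Delta_bot\<^esub> f = h \<cdot>\<^bsub>Delta_bot\<^esub> (g \<cdot>\<^bsub>Delta_bot\<^esub> f)"
    by (auto simp: hom_Delta_bot_iff Delta_bot_sel compose_def fun_eq_iff PiE_iff)
next
  fix f A A' f' A'' g B B' g' B''
  assume "f \<in> hom Delta_bot A A'" "f' \<in> hom Delta_bot A' A''"
    "g \<in> hom Delta_bot B B'" "g' \<in> hom Delta_bot B' B''"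
  then obtain \<xi> \<xi>' \<zeta> \<zeta>' where eqs: "f = (A, A', \<xi>)" "f' = (A', A'', \<xi>')" "g = (B, B', \<zeta>)" "g' = (B', B'', \<zeta>')"
    and \<xi>: "\<xi> \<in> {..<A} \<rightarrow>\<^sub>E {..<A'}" and \<zeta>: "\<zeta> \<in> {..<B} \<rightarrow>\<^sub>E {..<B'}"
    by (auto simp: hom_Delta_bot_iff)
  have "\<xi> i < A' + k" if "i < A" for i k
    using PiE_lt[OF \<xi> that] by linarith
  moreover have "\<zeta> (i - A) < B'" if "i < A + B" "\<not> i < A" for i
    using PiE_lt[OF \<zeta>, of "i - A"] that by linarith
  ultimately show "(f' \<cdot>\<^bsub>Delta_bot\<^esub> f) \<boxtimes>\<^bsub>Delta_bot\<^esub> (g' \<cdot>\<^bsub>Delta_bot\<^esub> g)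
      = (f' \<boxtimes>\<^bsub>Delta_bot\<^esub> g') \<cdot>\<^bsub>Delta_bot\<^esub> (f \<boxtimes>\<^bsub>Delta_bot\<^esub> g)"
    using PiE_lt[OF \<xi>] by (auto simp: eqs Delta_bot_sel compose_def fun_eq_iff)
next
  fix f X X' g Y Y' h Z Z'
  assume "f \<in> hom Delta_bot X X'" "g \<in> hom Delta_bot Y Y'" "h \<in> hom Delta_bot Z Z'"
  then obtain \<xi> \<zeta> \<chi> where eqs: "f = (X, X', \<xi>)" "g = (Y, Y', \<zeta>)" "h = (Z, Z', \<chi>)"
    and \<xi>: "\<xi> \<in> {..<X} \<rightarrow>\<^sub>E {..<X'}" and \<zeta>: "\<zeta> \<in> {..<Y} \<rightarrow>\<^sub>E {..<Y'}" and \<chi>: "\<chi> \<in> {..<Z} \<rightarrow>\<^sub>E {..<Z'}"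
    by (auto simp: hom_Delta_bot_iff)
  have 1: "\<xi> i < X' + Y' + Z'" if "i < X" for i
    using PiE_lt[OF \<xi> that] by linarith
  have 2: "\<zeta> (i - X) < Y' + Z'" if "i < X + Y" "\<not> i < X" for i
    using PiE_lt[OF \<zeta>, of "i - X"] that by linarith
  have 3: "\<chi> (i - (X + Y)) < Z'" if "i < X + Y + Z" "\<not> i < X + Y" for i
    using PiE_lt[OF \<chi>, of "i - (X + Y)"] that by linarith
  show "Assoc Delta_bot X' Y' Z' \<cdot>\<^bsub>Delta_bot\<^esub> ((f \<boxtimes>\<^bsub>Delta_bot\<^esub> g) \<boxtimes>\<^bsub>Delta_bot\<^esub> h)
      = (f \<boxtimes>\<^bsub>Delta_bot\<^esub> (g \<boxtimes>\<^bsub>Delta_bot\<^esub> h)) \<cdot>\<^bsub>Delta_bot\<^esub> Assoc Delta_bot X Y Z"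
    using 1 2 3 by (auto simp: eqs Delta_bot_sel compose_def fun_eq_iff add.assoc)
next
  fix X assume "X \<in> Obj Delta_bot"
  then show "Ident Delta_bot X \<in> hom Delta_bot X X"
    and "LUnit Delta_bot X \<in> hom Delta_bot (Unit Delta_bot \<otimes>\<^bsub>Delta_bot\<^esub> X) X"
    and "RUnit Delta_bot X \<in> hom Delta_bot X (X \<otimes>\<^bsub>Delta_bot\<^esub> Unit Delta_bot)"
    by (auto simp: triple_hom_Delta_bot_iff Delta_bot_sel mono_on_def)
next
  fix X Y Z assume "X \<in> Obj Delta_bot" "Y \<in> Obj Delta_bot" "Z \<in> Obj Delta_bot"
  then show "Assoc Delta_bot X Y Z \<in> hom Delta_bot
      ((X \<otimes>\<^bsub>Delta_bot\<^esub> Y) \<otimes>\<^bsub>Delta_bot\<^esub> Z) (X \<otimes>\<^bsub>Delta_bot\<^esub> (Y \<otimes>\<^bsub>Delta_bot\<^esub> Z))"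
    by (auto simp: triple_hom_Delta_bot_iff Delta_bot_sel mono_on_def)
qed (auto simp: Delta_bot_sel compose_def fun_eq_iff)

end

theory Submission
  imports Defs "HOL-Library.Countable_Set"
begin

text \<open>Every arrow of the free category is the interpretation of a cut-free derivation in the sequent
  calculus for skew monoidal categories (after Uustalu, Veltri and Zeilberger).  Composites stay
  derivable by cut elimination.  A derivation can be read off from its image \<open>\<xi>\<close> in \<open>\<Delta>\<^sub>\<bottom>\<close>: a
  derivation of an arrow out of \<open>(\<dots>((I \<otimes> Y) \<otimes> Z\<^sub>1)\<dots>) \<otimes> Z\<^sub>n\<close> may end with the rule that uses \<open>\<lambda>\<^sub>Y\<close>
  exactly if \<open>\<xi> 1 = 0\<close>, and otherwise the preimage of the first summand of the codomain says where
  the tensor rule splits the domain.  Hence arrows with the same domain, codomain and image are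
  equal.\<close>

section \<open>Moving a context into the second tensor factor\<close>

text \<open>Derivability is a predicate on the arrows of a given category, not a datatype of proofs,
  so derivations are compared only through the arrows they denote. Coherence is concentrated in the
  arrows \<open>shift\<close>: \<open>pentagon\<close> and \<open>Assoc_RUnit\<close> give
  \<open>shift_shift\<close>, \<open>LUnit_Assoc\<close> and \<open>LUnit_RUnit\<close> give
  \<open>LUnit_shift\<close>, and \<open>LUnit_Assoc_RUnit\<close> makes tensors of arrows and
  \<alpha> derivable. Generator and unit both go to the ordinal 1, so an image in
  \<open>Delta_bot\<close> cannot tell them apart. The trees of domain and codomain must therefore
  be recoverable from the objects, that is, \<open>ev\<close> must be injective for a free category.
  A further obstacle is that freeness speaks only of categories on the types of \<open>F\<close>.
  \<open>Delta_bot\<close> and the auxiliary category on trees live on other types and are copied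
  along injections, which countability provides.\<close>

context skew_monoidal_category
begin

section \<open>Typing and rewriting rules for arrows\<close>

lemma arr_Ident [simp]:
  assumes "A \<in> Obj C"
  shows "Ident C A \<in> Arr C" "Dom C (Ident C A) = A" "Cod C (Ident C A) = A"
  using Ident_hom[OF assms] by (auto simp: hom_def)

lemma arr_Comp [simp]:
  assumes "f \<in> Arr C" "g \<in> Arr C" "Dom C g = Cod C f"
  shows "g \<cdot> f \<in> Arr C" "Dom C (g \<cdot> f) = Dom C f" "Cod C (g \<cdot> f) = Cod C g"
  using Comp_hom[of f "Dom C f" "Cod C f" g "Cod C g"] assms by (auto simp: hom_def)

lemma arr_TensorA [simp]:
  assumes "f \<in> Arr C" "g \<in> Arr C"
  shows "f \<boxtimes> g \<in> Arr C" "Dom C (f \<boxtimes> g) = Dom C f \<otimes> Dom C g"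
    "Cod C (f \<boxtimes> g) = Cod C f \<otimes> Cod C g"
  using TensorA_hom[of f "Dom C f" "Cod C f" g "Dom C g" "Cod C g"] assms by (auto simp: hom_def)

lemma arr_Assoc [simp]:
  assumes "X \<in> Obj C" "Y \<in> Obj C" "Z \<in> Obj C"
  shows "Assoc C X Y Z \<in> Arr C" "Dom C (Assoc C X Y Z) = (X \<otimes> Y) \<otimes> Z"
    "Cod C (Assoc C X Y Z) = X \<otimes> (Y \<otimes> Z)"
  using Assoc_hom[OF assms] by (auto simp: hom_def)

lemma arr_LUnit [simp]:
  assumes "X \<in> Obj C"
  shows "LUnit C X \<in> Arr C" "Dom C (LUnit C X) = Unit C \<otimes> X" "Cod C (LUnit C X) = X"
  using LUnit_hom[OF assms] by (auto simp: hom_def)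

lemma arr_RUnit [simp]:
  assumes "X \<in> Obj C"
  shows "RUnit C X \<in> Arr C" "Dom C (RUnit C X) = X" "Cod C (RUnit C X) = X \<otimes> Unit C"
  using RUnit_hom[OF assms] by (auto simp: hom_def)

declare Unit_Obj [simp] TensorO_Obj [simp] Dom_Obj [simp] Cod_Obj [simp]

lemma Comp_Ident_arr [simp]: "f \<in> Arr C \<Longrightarrow> Dom C f = A \<Longrightarrow> f \<cdot> Ident C A = f"
  using Comp_Ident[of f A "Cod C f"] by (auto simp: hom_def)

lemma Ident_Comp_arr [simp]: "f \<in> Arr C \<Longrightarrow> Cod C f = A \<Longrightarrow> Ident C A \<cdot> f = f"
  using Ident_Comp[of f "Dom C f" A] by (auto simp: hom_def)

lemma Comp_assoc_arr:
  "f \<in> Arr C \<Longrightarrow> g \<in> Arr C \<Longrightarrow> h \<in> Arr C \<Longrightarrow> Dom C g = Cod C f \<Longrightarrow> Dom C h = Cod C g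
    \<Longrightarrow> (h \<cdot> g) \<cdot> f = h \<cdot> (g \<cdot> f)"
  using Comp_assoc[of f "Dom C f" "Cod C f" g "Cod C g" h "Cod C h"] by (auto simp: hom_def)

lemma interchange:
  "f \<in> Arr C \<Longrightarrow> g \<in> Arr C \<Longrightarrow> f' \<in> Arr C \<Longrightarrow> g' \<in> Arr C \<Longrightarrow> Dom C f' = Cod C f \<Longrightarrow> Dom C g' = Cod C g
    \<Longrightarrow> (f' \<boxtimes> g') \<cdot> (f \<boxtimes> g) = (f' \<cdot> f) \<boxtimes> (g' \<cdot> g)"
  using TensorA_Comp[of f "Dom C f" "Cod C f" f' "Cod C f'" g "Dom C g" "Cod C g" g' "Cod C g'"]
  by (auto simp: hom_def)

text \<open>Composition associates to the right, so an equation between two-fold composites does not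
  match inside a longer one. The variants ending in \<open>_Comp\<close> carry the remaining arrow
  along.\<close>

lemma interchange_Comp:
  "f \<in> Arr C \<Longrightarrow> g \<in> Arr C \<Longrightarrow> f' \<in> Arr C \<Longrightarrow> g' \<in> Arr C \<Longrightarrow> Dom C f' = Cod C f \<Longrightarrow> Dom C g' = Cod C g
    \<Longrightarrow> h \<in> Arr C \<Longrightarrow> Cod C h = Dom C f \<otimes> Dom C g
    \<Longrightarrow> (f' \<boxtimes> g') \<cdot> (f \<boxtimes> g) \<cdot> h = ((f' \<cdot> f) \<boxtimes> (g' \<cdot> g)) \<cdot> h"
  using Comp_assoc_arr[of h "f \<boxtimes> g" "f' \<boxtimes> g'"] by (simp add: interchange)

lemma Assoc_natural_arr:
  assumes "f \<in> Arr C" "g \<in> Arr C" "h \<in> Arr C"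
    "Cod C f = X'" "Cod C g = Y'" "Cod C h = Z'"
  shows "Assoc C X' Y' Z' \<cdot> ((f \<boxtimes> g) \<boxtimes> h)
    = (f \<boxtimes> (g \<boxtimes> h)) \<cdot> Assoc C (Dom C f) (Dom C g) (Dom C h)"
  by (rule Assoc_natural) (use assms in \<open>simp_all add: hom_def\<close>)

lemma Assoc_natural_Comp:
  assumes "f \<in> Arr C" "g \<in> Arr C" "h \<in> Arr C"
    "Cod C f = X'" "Cod C g = Y'" "Cod C h = Z'"
    "k \<in> Arr C" "Cod C k = (Dom C f \<otimes> Dom C g) \<otimes> Dom C h"
  shows "Assoc C X' Y' Z' \<cdot> ((f \<boxtimes> g) \<boxtimes> h) \<cdot> k
    = (f \<boxtimes> (g \<boxtimes> h)) \<cdot> Assoc C (Dom C f) (Dom C g) (Dom C h) \<cdot> k"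
proof -
  have "Assoc C X' Y' Z' \<cdot> ((f \<boxtimes> g) \<boxtimes> h) \<cdot> k = (Assoc C X' Y' Z' \<cdot> ((f \<boxtimes> g) \<boxtimes> h)) \<cdot> k"
    using assms by (subst Comp_assoc_arr) auto
  also have "\<dots> = (f \<boxtimes> (g \<boxtimes> h)) \<cdot> Assoc C (Dom C f) (Dom C g) (Dom C h) \<cdot> k"
    using assms by (simp add: Assoc_natural_arr Comp_assoc_arr)
  finally show ?thesis .
qed

lemma LUnit_natural_arr:
  "f \<in> Arr C \<Longrightarrow> Cod C f = X' \<Longrightarrow> LUnit C X' \<cdot> (Ident C (Unit C) \<boxtimes> f) = f \<cdot> LUnit C (Dom C f)"
  by (rule LUnit_natural) (simp add: hom_def)

lemma RUnit_natural_arr: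
  "f \<in> Arr C \<Longrightarrow> Cod C f = X' \<Longrightarrow> RUnit C X' \<cdot> f = (f \<boxtimes> Ident C (Unit C)) \<cdot> RUnit C (Dom C f)"
  by (rule RUnit_natural) (simp add: hom_def)

declare TensorA_Ident [simp]

text \<open>Contexts are stored in reverse, so that \<open>spine [Z\<^sub>n, \<dots>, Z\<^sub>1] A\<close> is
  \<open>(\<dots>(A \<otimes> Z\<^sub>1) \<otimes> \<dots>) \<otimes> Z\<^sub>n\<close>.\<close>

primrec spine :: "'o list \<Rightarrow> 'o \<Rightarrow> 'o" where
  "spine [] A = A"
| "spine (Z # \<Gamma>) A = spine \<Gamma> A \<otimes> Z"

primrec spineA :: "'o list \<Rightarrow> 'a \<Rightarrow> 'a" where
  "spineA [] f = f"
| "spineA (Z # \<Gamma>) f = spineA \<Gamma> f \<boxtimes> Ident C Z"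

text \<open>Here \<rho> creates a unit that becomes the head of the context, and one \<alpha> per
  entry rebrackets. The arrow interprets the splitting of a context by the tensor rule, whose second
  premise has the unit in place of \<open>A\<close>.\<close>

primrec shift :: "'o \<Rightarrow> 'o list \<Rightarrow> 'a" where
  "shift A [] = RUnit C A"
| "shift A (Z # \<Delta>) = Assoc C A (spine \<Delta> (Unit C)) Z \<cdot> (shift A \<Delta> \<boxtimes> Ident C Z)"

lemma spine_append: "spine (\<Gamma> @ \<Delta>) A = spine \<Gamma> (spine \<Delta> A)"
  by (induction \<Gamma>) auto

lemma spineA_append: "spineA (\<Gamma> @ \<Delta>) f = spineA \<Gamma> (spineA \<Delta> f)"
  by (induction \<Gamma>) auto

lemma spine_Obj [simp]: "set \<Gamma> \<subseteq> Obj C \<Longrightarrow> A \<in> Obj C \<Longrightarrow> spine \<Gamma> A \<in> Obj C"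
  by (induction \<Gamma>) auto

lemma arr_spineA [simp]:
  assumes "set \<Gamma> \<subseteq> Obj C" "f \<in> Arr C"
  shows "spineA \<Gamma> f \<in> Arr C" "Dom C (spineA \<Gamma> f) = spine \<Gamma> (Dom C f)"
    "Cod C (spineA \<Gamma> f) = spine \<Gamma> (Cod C f)"
  using assms by (induction \<Gamma>) auto

lemma spineA_Ident [simp]:
  "set \<Gamma> \<subseteq> Obj C \<Longrightarrow> A \<in> Obj C \<Longrightarrow> spineA \<Gamma> (Ident C A) = Ident C (spine \<Gamma> A)"
  by (induction \<Gamma>) auto

lemma spineA_Comp:
  "set \<Gamma> \<subseteq> Obj C \<Longrightarrow> f \<in> Arr C \<Longrightarrow> g \<in> Arr C \<Longrightarrow> Dom C g = Cod C f
    \<Longrightarrow> spineA \<Gamma> (g \<cdot> f) = spineA \<Gamma> g \<cdot> spineA \<Gamma> f"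
  by (induction \<Gamma>) (auto simp: interchange)

lemma arr_shift [simp]:
  assumes "set \<Delta> \<subseteq> Obj C" "A \<in> Obj C"
  shows "shift A \<Delta> \<in> Arr C" "Dom C (shift A \<Delta>) = spine \<Delta> A"
    "Cod C (shift A \<Delta>) = A \<otimes> spine \<Delta> (Unit C)"
  using assms by (induction \<Delta>) auto

lemma shift_natural:
  assumes "set \<Delta> \<subseteq> Obj C" "f \<in> Arr C"
  shows "shift (Cod C f) \<Delta> \<cdot> spineA \<Delta> f
    = (f \<boxtimes> Ident C (spine \<Delta> (Unit C))) \<cdot> shift (Dom C f) \<Delta>"
  using assms
proof (induction \<Delta>)
  case Nil
  then show ?case by (simp add: RUnit_natural_arr)
next
  case (Cons Z \<Delta>)
  have "shift (Cod C f) (Z # \<Delta>) \<cdot> spineA (Z # \<Delta>) f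
    = Assoc C (Cod C f) (spine \<Delta> (Unit C)) Z
      \<cdot> ((shift (Cod C f) \<Delta> \<cdot> spineA \<Delta> f) \<boxtimes> Ident C Z)"
    using Cons.prems by (simp add: Comp_assoc_arr interchange)
  also have "\<dots> = Assoc C (Cod C f) (spine \<Delta> (Unit C)) Z
      \<cdot> (((f \<boxtimes> Ident C (spine \<Delta> (Unit C))) \<boxtimes> Ident C Z) \<cdot> (shift (Dom C f) \<Delta> \<boxtimes> Ident C Z))"
    using Cons by (simp add: interchange)
  also have "\<dots> = (f \<boxtimes> Ident C (spine (Z # \<Delta>) (Unit C))) \<cdot> shift (Dom C f) (Z # \<Delta>)"
    using Cons.prems by (simp add: Assoc_natural_Comp)
  finally show ?case .
qed

text \<open>Each outer entry adds one \<alpha>, which is natural in its middle argument, so a square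
  for the inner contexts extends to \<open>\<Gamma>\<close>. Needed for a cut formula deep inside a
  context.\<close>

lemma shift_context_natural:
  assumes "set \<Gamma> \<subseteq> Obj C" "set \<Psi> \<subseteq> Obj C" "set \<Psi>' \<subseteq> Obj C" "B \<in> Obj C"
    and "u \<in> hom C (spine \<Psi> B) (spine \<Psi>' B)"
    and "v \<in> hom C (spine \<Psi> (Unit C)) (spine \<Psi>' (Unit C))"
    and "shift B \<Psi>' \<cdot> u = (Ident C B \<boxtimes> v) \<cdot> shift B \<Psi>"
  shows "shift B (\<Gamma> @ \<Psi>') \<cdot> spineA \<Gamma> u = (Ident C B \<boxtimes> spineA \<Gamma> v) \<cdot> shift B (\<Gamma> @ \<Psi>)"
  using assms(1)
proof (induction \<Gamma>)
  case Nil
  then show ?case using assms by simp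
next
  case (Cons Z \<Gamma>)
  have *: "u \<in> Arr C" "Dom C u = spine \<Psi> B" "Cod C u = spine \<Psi>' B"
    "v \<in> Arr C" "Dom C v = spine \<Psi> (Unit C)" "Cod C v = spine \<Psi>' (Unit C)"
    using assms by (auto simp: hom_def)
  have "shift B ((Z # \<Gamma>) @ \<Psi>') \<cdot> spineA (Z # \<Gamma>) u
    = Assoc C B (spine (\<Gamma> @ \<Psi>') (Unit C)) Z \<cdot> ((shift B (\<Gamma> @ \<Psi>') \<cdot> spineA \<Gamma> u) \<boxtimes> Ident C Z)"
    using Cons.prems assms(2-4) *
    by (simp add: Comp_assoc_arr interchange spine_append)
  also have "\<dots> = Assoc C B (spine (\<Gamma> @ \<Psi>') (Unit C)) Z
    \<cdot> (((Ident C B \<boxtimes> spineA \<Gamma> v) \<boxtimes> Ident C Z) \<cdot> (shift B (\<Gamma> @ \<Psi>) \<boxtimes> Ident C Z))"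
    using Cons assms(2-4) * by (simp add: interchange spine_append)
  also have "\<dots> = (Ident C B \<boxtimes> spineA (Z # \<Gamma>) v) \<cdot> shift B ((Z # \<Gamma>) @ \<Psi>)"
    using Cons.prems assms(2-4) * by (simp add: Assoc_natural_Comp spine_append)
  finally show ?case .
qed

text \<open>The base case is \<open>LUnit_RUnit\<close>, and \<open>LUnit_Assoc\<close> absorbs one
  \<alpha> per entry. In the principal case of the cut this cancels \<open>shift\<close> against the
  \<lambda> of passivation.\<close>

lemma LUnit_shift:
  "set \<Delta> \<subseteq> Obj C \<Longrightarrow>
    LUnit C (spine \<Delta> (Unit C)) \<cdot> shift (Unit C) \<Delta> = Ident C (spine \<Delta> (Unit C))"
proof (induction \<Delta>)
  case Nil
  then show ?case by (simp add: LUnit_RUnit)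
next
  case (Cons Z \<Delta>)
  have "LUnit C (spine (Z # \<Delta>) (Unit C)) \<cdot> shift (Unit C) (Z # \<Delta>)
    = (LUnit C (spine \<Delta> (Unit C) \<otimes> Z) \<cdot> Assoc C (Unit C) (spine \<Delta> (Unit C)) Z)
      \<cdot> (shift (Unit C) \<Delta> \<boxtimes> Ident C Z)"
    using Cons.prems by (simp add: Comp_assoc_arr)
  also have "\<dots> = Ident C (spine (Z # \<Delta>) (Unit C))"
    using Cons by (simp add: LUnit_Assoc interchange)
  finally show ?case .
qed

text \<open>The base case is naturality of \<rho> with \<open>Assoc_RUnit\<close>, and each entry of
  \<open>\<Delta>\<close> costs one \<open>pentagon\<close>. This is a coassociativity law:
  splitting off the outer part and then the inner part agrees with splitting off both at once and
  dividing them afterwards.\<close>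

lemma shift_shift:
  assumes "set \<Delta> \<subseteq> Obj C" "set \<Psi> \<subseteq> Obj C" "B \<in> Obj C"
  shows "Assoc C B (spine \<Psi> (Unit C)) (spine \<Delta> (Unit C))
      \<cdot> (shift B \<Psi> \<boxtimes> Ident C (spine \<Delta> (Unit C))) \<cdot> shift (spine \<Psi> B) \<Delta>
    = (Ident C B \<boxtimes> shift (spine \<Psi> (Unit C)) \<Delta>) \<cdot> shift B (\<Delta> @ \<Psi>)"
  using assms
proof (induction \<Delta>)
  case Nil
  have "(shift B \<Psi> \<boxtimes> Ident C (Unit C)) \<cdot> RUnit C (spine \<Psi> B)
    = RUnit C (B \<otimes> spine \<Psi> (Unit C)) \<cdot> shift B \<Psi>"
    using Nil.prems RUnit_natural_arr[of "shift B \<Psi>"] by simp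
  moreover have "Assoc C B (spine \<Psi> (Unit C)) (Unit C) \<cdot> RUnit C (B \<otimes> spine \<Psi> (Unit C)) \<cdot> shift B \<Psi>
    = (Ident C B \<boxtimes> RUnit C (spine \<Psi> (Unit C))) \<cdot> shift B \<Psi>"
    using Nil.prems Assoc_RUnit[of B "spine \<Psi> (Unit C)"]
      Comp_assoc_arr[of "shift B \<Psi>" "RUnit C (B \<otimes> spine \<Psi> (Unit C))"
        "Assoc C B (spine \<Psi> (Unit C)) (Unit C)"] by simp
  ultimately show ?case by simp
next
  case (Cons Z \<Delta>)
  let ?P = "spine \<Psi> (Unit C)" and ?D = "spine \<Delta> (Unit C)"
  have o [simp]: "?P \<in> Obj C" "?D \<in> Obj C" "B \<in> Obj C" "Z \<in> Obj C" "set \<Delta> \<subseteq> Obj C" "set \<Psi> \<subseteq> Obj C"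
    using Cons.prems by auto
  let ?s = "shift B \<Psi>" and ?t = "shift (spine \<Psi> B) \<Delta>" and ?Z = "Ident C Z"
  have "Assoc C B ?P (?D \<otimes> Z) \<cdot> (?s \<boxtimes> Ident C (?D \<otimes> Z)) \<cdot> shift (spine \<Psi> B) (Z # \<Delta>)
    = Assoc C B ?P (?D \<otimes> Z) \<cdot> (?s \<boxtimes> (Ident C ?D \<boxtimes> ?Z)) \<cdot> Assoc C (spine \<Psi> B) ?D Z \<cdot> (?t \<boxtimes> ?Z)"
    by simp
  also have "\<dots> = Assoc C B ?P (?D \<otimes> Z) \<cdot> Assoc C (B \<otimes> ?P) ?D Z \<cdot> ((?s \<boxtimes> Ident C ?D) \<boxtimes> ?Z) \<cdot> (?t \<boxtimes> ?Z)"
    using Assoc_natural_Comp[of ?s "Ident C ?D" ?Z "B \<otimes> ?P" ?D Z "?t \<boxtimes> ?Z"]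
    by simp
  also have "\<dots> = (Assoc C B ?P (?D \<otimes> Z) \<cdot> Assoc C (B \<otimes> ?P) ?D Z) \<cdot> ((?s \<boxtimes> Ident C ?D) \<boxtimes> ?Z) \<cdot> (?t \<boxtimes> ?Z)"
    by (simp add: Comp_assoc_arr)
  also have "\<dots> = (Ident C B \<boxtimes> Assoc C ?P ?D Z) \<cdot> Assoc C B (?P \<otimes> ?D) Z
      \<cdot> (Assoc C B ?P ?D \<boxtimes> ?Z) \<cdot> ((?s \<boxtimes> Ident C ?D) \<boxtimes> ?Z) \<cdot> (?t \<boxtimes> ?Z)"
    by (simp add: pentagon[symmetric] Comp_assoc_arr)
  also have "\<dots> = (Ident C B \<boxtimes> Assoc C ?P ?D Z) \<cdot> Assoc C B (?P \<otimes> ?D) Z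
      \<cdot> ((Assoc C B ?P ?D \<cdot> (?s \<boxtimes> Ident C ?D) \<cdot> ?t) \<boxtimes> ?Z)"
    by (simp add: interchange)
  also have "\<dots> = (Ident C B \<boxtimes> Assoc C ?P ?D Z) \<cdot> Assoc C B (?P \<otimes> ?D) Z
      \<cdot> ((Ident C B \<boxtimes> shift ?P \<Delta>) \<boxtimes> ?Z) \<cdot> (shift B (\<Delta> @ \<Psi>) \<boxtimes> ?Z)"
    using Cons.IH by (simp add: interchange spine_append)
  also have "\<dots> = (Ident C B \<boxtimes> Assoc C ?P ?D Z) \<cdot> (Ident C B \<boxtimes> (shift ?P \<Delta> \<boxtimes> ?Z))
      \<cdot> Assoc C B (spine \<Delta> ?P) Z \<cdot> (shift B (\<Delta> @ \<Psi>) \<boxtimes> ?Z)"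
    by (simp add: Assoc_natural_Comp spine_append)
  also have "\<dots> = (Ident C B \<boxtimes> shift ?P (Z # \<Delta>)) \<cdot> shift B ((Z # \<Delta>) @ \<Psi>)"
    by (simp add: interchange_Comp spine_append)
  finally show ?case by simp
qed

text \<open>Provides the inner square for \<open>shift_context_natural\<close> when the entry
  \<open>Cod C f\<close> is replaced by the context \<open>\<Delta>\<close> from which
  \<open>f\<close> derives it.\<close>

lemma shift_slide:
  assumes "set \<Delta> \<subseteq> Obj C" "set \<Psi> \<subseteq> Obj C" "B \<in> Obj C"
    and "f \<in> Arr C" "Dom C f = spine \<Delta> (Unit C)"
  shows "shift B (Cod C f # \<Psi>) \<cdot> (Ident C (spine \<Psi> B) \<boxtimes> f) \<cdot> shift (spine \<Psi> B) \<Delta>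
    = (Ident C B \<boxtimes> ((Ident C (spine \<Psi> (Unit C)) \<boxtimes> f) \<cdot> shift (spine \<Psi> (Unit C)) \<Delta>))
        \<cdot> shift B (\<Delta> @ \<Psi>)"
proof -
  let ?P = "spine \<Psi> (Unit C)" and ?D = "spine \<Delta> (Unit C)"
  let ?s = "shift B \<Psi>" and ?t = "shift (spine \<Psi> B) \<Delta>"
  note [simp] = assms
  have "shift B (Cod C f # \<Psi>) \<cdot> (Ident C (spine \<Psi> B) \<boxtimes> f) \<cdot> ?t
    = Assoc C B ?P (Cod C f) \<cdot> (?s \<boxtimes> f) \<cdot> ?t"
    by (simp add: Comp_assoc_arr interchange_Comp)
  also have "\<dots> = Assoc C B ?P (Cod C f) \<cdot> ((Ident C B \<boxtimes> Ident C ?P) \<boxtimes> f)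
      \<cdot> (?s \<boxtimes> Ident C ?D) \<cdot> ?t"
    by (simp add: interchange_Comp)
  also have "\<dots> = (Ident C B \<boxtimes> (Ident C ?P \<boxtimes> f)) \<cdot> Assoc C B ?P ?D \<cdot> (?s \<boxtimes> Ident C ?D) \<cdot> ?t"
    by (subst Assoc_natural_Comp) simp_all
  also have "\<dots> = (Ident C B \<boxtimes> (Ident C ?P \<boxtimes> f)) \<cdot> (Ident C B \<boxtimes> shift ?P \<Delta>) \<cdot> shift B (\<Delta> @ \<Psi>)"
    by (simp add: shift_shift)
  also have "\<dots> = (Ident C B \<boxtimes> ((Ident C ?P \<boxtimes> f) \<cdot> shift ?P \<Delta>)) \<cdot> shift B (\<Delta> @ \<Psi>)"
    by (simp add: interchange_Comp spine_append)
  finally show ?thesis .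
qed

end

section \<open>Cut-free derivations\<close>

datatype tree = Gen | Uni | Ten tree tree

text \<open>Lets the auxiliary category on trees be copied onto any infinite types.\<close>

instance tree :: countable
  by countable_datatype

primrec tspine :: "tree list \<Rightarrow> tree \<Rightarrow> tree" where
  "tspine [] A = A"
| "tspine (Z # \<Gamma>) A = Ten (tspine \<Gamma> A) Z"

lemma tspine_append: "tspine (\<Gamma> @ \<Delta>) A = tspine \<Gamma> (tspine \<Delta> A)"
  by (induction \<Gamma>) auto

lemma Uni_eq_tspine [elim]: "Uni = tspine \<Gamma> A \<Longrightarrow> (\<Gamma> = [] \<Longrightarrow> A = Uni \<Longrightarrow> P) \<Longrightarrow> P"
  by (cases \<Gamma>) auto

text \<open>Both sides cut the same left spine, and of two cutting points one lies above the other.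
  The case splits on the place of a subtree rest on this.\<close>

lemma tspine_eq_tspine:
  assumes "tspine \<Gamma> A = tspine \<Delta> B"
  obtains \<Theta> where "\<Gamma> = \<Delta> @ \<Theta>" "B = tspine \<Theta> A" | \<Theta> where "\<Delta> = \<Gamma> @ \<Theta>" "A = tspine \<Theta> B"
  using assms
proof (induction \<Gamma> arbitrary: \<Delta> thesis)
  case Nil
  then show ?case by auto
next
  case (Cons Z \<Gamma>)
  show ?case
  proof (cases \<Delta>)
    case Nil
    then show ?thesis using Cons.prems(1)[of "Z # \<Gamma>"] Cons.prems(3) by simp
  next
    case (Cons Y \<Delta>')
    with Cons.prems(3) have "tspine \<Gamma> A = tspine \<Delta>' B" and [simp]: "Y = Z" by auto
    then show ?thesis
      using Cons.IH[of \<Delta>' thesis] Cons.prems(1,2) \<open>\<Delta> = Y # \<Delta>'\<close> by auto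
  qed
qed

text \<open>The ordinal that a functor to \<open>Delta_bot\<close> sending the generator to the unit
  assigns to a tree, see \<open>map_obj_ev\<close>; also the measure for
  \<open>derivable_unique\<close>.\<close>

primrec leaves :: "tree \<Rightarrow> nat" where
  "leaves Gen = 1"
| "leaves Uni = 1"
| "leaves (Ten A B) = leaves A + leaves B"

lemma leaves_pos [simp]: "0 < leaves A"
  by (induction A) auto

lemma leaves_neq_0 [simp]: "leaves A \<noteq> 0"
  using leaves_pos[of A] by linarith

lemma leaves_tspine: "leaves (tspine \<Gamma> A) = leaves A + sum_list (map leaves \<Gamma>)"
  by (induction \<Gamma>) auto

locale pointed_skew_monoidal_category = skew_monoidal_category C
  for C :: "('o, 'a, 'm) skew_monoidal_scheme" (structure) and X :: 'o +
  assumes X_Obj [simp]: "X \<in> Obj C"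
begin

primrec ev :: "tree \<Rightarrow> 'o" where
  "ev Gen = X"
| "ev Uni = Unit C"
| "ev (Ten A B) = ev A \<otimes> ev B"

lemma ev_Obj [simp]: "ev A \<in> Obj C"
  by (induction A) auto

lemma ev_image_Obj [simp]: "ev ` S \<subseteq> Obj C"
  by auto

lemma ev_tspine [simp]: "ev (tspine \<Gamma> A) = spine (map ev \<Gamma>) (ev A)"
  by (induction \<Gamma>) auto

text \<open>The left rules of the sequent calculus for the unit and the tensor become identities, because
  the sequent \<open>A | Z\<^sub>1, \<dots>, Z\<^sub>n \<turnstile> B\<close> is identified with the hom-set from
  \<open>(\<dots>(A \<otimes> Z\<^sub>1) \<otimes> \<dots>) \<otimes> Z\<^sub>n\<close> to \<open>B\<close>, and the empty stoup with the unit.\<close>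

inductive derivable :: "tree \<Rightarrow> tree \<Rightarrow> 'a \<Rightarrow> bool" where
  ident: "derivable A A (Ident C (ev A))"
| passivate: "derivable (tspine \<Gamma> Y) B f
    \<Longrightarrow> derivable (tspine \<Gamma> (Ten Uni Y)) B (f \<cdot> spineA (map ev \<Gamma>) (LUnit C (ev Y)))"
| tensor: "derivable A B f \<Longrightarrow> derivable (tspine \<Delta> Uni) Z g
    \<Longrightarrow> derivable (tspine \<Delta> A) (Ten B Z) ((f \<boxtimes> g) \<cdot> shift (ev A) (map ev \<Delta>))"

lemma derivable_arr:
  "derivable A B f \<Longrightarrow> f \<in> Arr C \<and> Dom C f = ev A \<and> Cod C f = ev B"
  by (induction rule: derivable.induct) auto

lemma passivate':
  "derivable W B f \<Longrightarrow> W = tspine \<Gamma> Y \<Longrightarrow> V = tspine \<Gamma> (Ten Uni Y)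
    \<Longrightarrow> g = f \<cdot> spineA (map ev \<Gamma>) (LUnit C (ev Y)) \<Longrightarrow> derivable V B g"
  using passivate by blast

lemma tensor':
  "derivable A B f \<Longrightarrow> derivable W Z g \<Longrightarrow> W = tspine \<Delta> Uni \<Longrightarrow> V = tspine \<Delta> A
    \<Longrightarrow> h = (f \<boxtimes> g) \<cdot> shift (ev A) (map ev \<Delta>) \<Longrightarrow> derivable V (Ten B Z) h"
  using tensor by blast

section \<open>Derivability of the structural arrows and of tensors\<close>

lemma derivable_LUnit_Comp: "derivable A B f \<Longrightarrow> derivable (Ten Uni A) B (f \<cdot> LUnit C (ev A))"
  by (rule passivate'[where \<Gamma> = "[]"]) auto

lemma derivable_LUnit: "derivable (Ten Uni A) A (LUnit C (ev A))"
  using derivable_LUnit_Comp[OF ident, of A] by simp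

lemma derivable_RUnit: "derivable A (Ten A Uni) (RUnit C (ev A))"
  by (rule tensor'[OF ident ident, where \<Delta> = "[]"]) auto

text \<open>The unit inserted by \<rho> is removed again by \<lambda>, which is
  \<open>LUnit_Assoc_RUnit\<close>. So a plain tensor is an instance of the tensor rule with a
  one-entry context and a passivated second premise.\<close>

lemma tensor_eq:
  assumes "f \<in> Arr C" "g \<in> Arr C"
  shows "(f \<boxtimes> (g \<cdot> LUnit C (Dom C g))) \<cdot> shift (Dom C f) [Dom C g] = f \<boxtimes> g"
proof -
  have "(f \<boxtimes> (g \<cdot> LUnit C (Dom C g))) \<cdot> shift (Dom C f) [Dom C g]
    = (f \<boxtimes> g) \<cdot> (Ident C (Dom C f) \<boxtimes> LUnit C (Dom C g)) \<cdot> Assoc C (Dom C f) (Unit C) (Dom C g)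
      \<cdot> (RUnit C (Dom C f) \<boxtimes> Ident C (Dom C g))"
    using assms by (simp add: interchange_Comp)
  also have "\<dots> = f \<boxtimes> g"
    using assms by (simp add: LUnit_Assoc_RUnit)
  finally show ?thesis .
qed

lemma derivable_TensorA:
  assumes "derivable A B f" "derivable D E g"
  shows "derivable (Ten A D) (Ten B E) (f \<boxtimes> g)"
  using derivable_arr[OF assms(1)] derivable_arr[OF assms(2)] tensor_eq[of f g]
  by (intro tensor'[OF assms(1) derivable_LUnit_Comp[OF assms(2)], where \<Delta> = "[D]"]) auto

lemma derivable_spineA:
  "derivable A B f \<Longrightarrow> derivable (tspine \<Gamma> A) (tspine \<Gamma> B) (spineA (map ev \<Gamma>) f)"
  by (induction \<Gamma>) (auto intro: derivable_TensorA ident)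

lemma derivable_Assoc:
  "derivable (Ten (Ten A B) D) (Ten A (Ten B D)) (Assoc C (ev A) (ev B) (ev D))"
\<comment> \<open>The stoup \<open>A\<close> stays alone and both \<open>B\<close> and
  \<open>D\<close> go to the second premise; contexts are reversed, hence \<open>[D, B]\<close>.
  Naturality of \<alpha> then brings the \<lambda> of \<open>B\<close> next to the inserted unit,
  where it cancels.\<close>
proof (rule tensor'[OF ident, where \<Delta> = "[D, B]"])
  show "derivable (Ten (Ten Uni B) D) (Ten B D) (LUnit C (ev B) \<boxtimes> Ident C (ev D))"
    using derivable_TensorA[OF derivable_LUnit ident] .
  have "(Ident C (ev A) \<boxtimes> (LUnit C (ev B) \<boxtimes> Ident C (ev D))) \<cdot> shift (ev A) (map ev [D, B])
    = (Ident C (ev A) \<boxtimes> (LUnit C (ev B) \<boxtimes> Ident C (ev D)))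
      \<cdot> Assoc C (ev A) (Unit C \<otimes> ev B) (ev D) \<cdot> (shift (ev A) [ev B] \<boxtimes> Ident C (ev D))"
    by simp
  also have "\<dots> = Assoc C (ev A) (ev B) (ev D)
      \<cdot> ((Ident C (ev A) \<boxtimes> LUnit C (ev B)) \<boxtimes> Ident C (ev D)) \<cdot> (shift (ev A) [ev B] \<boxtimes> Ident C (ev D))"
    by (subst Assoc_natural_Comp) simp_all
  also have "\<dots> = Assoc C (ev A) (ev B) (ev D)
      \<cdot> (((Ident C (ev A) \<boxtimes> LUnit C (ev B)) \<cdot> shift (ev A) [ev B]) \<boxtimes> Ident C (ev D))"
    by (simp add: interchange)
  also have "\<dots> = Assoc C (ev A) (ev B) (ev D)"
    by (simp add: LUnit_Assoc_RUnit)
  finally show "Assoc C (ev A) (ev B) (ev D)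
    = (Ident C (ev A) \<boxtimes> (LUnit C (ev B) \<boxtimes> Ident C (ev D))) \<cdot> shift (ev A) (map ev [D, B])" ..
qed (auto intro: ident)

text \<open>Induction on the derivation of \<open>g\<close>, with \<open>A\<close> arbitrary because
  the rules change the part of the spine inside the cut formula \<open>Z\<close>. Only passivation
  brings \<open>Z\<close> into the stoup; the cut needed there is the hypothesis
  \<open>stoup\<close>, which breaks the mutual recursion of the two cuts.\<close>

lemma derivable_context_cut:
  assumes f: "derivable (tspine \<Delta> Uni) Z f"
    and stoup: "\<And>\<Gamma> B g. derivable (tspine \<Gamma> Z) B g
      \<Longrightarrow> derivable (tspine \<Gamma> (tspine \<Delta> Uni)) B (g \<cdot> spineA (map ev \<Gamma>) f)"
    and "derivable (tspine \<Gamma> (Ten A Z)) B g"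
  shows "derivable (tspine \<Gamma> (tspine \<Delta> A)) B
    (g \<cdot> spineA (map ev \<Gamma>) ((Ident C (ev A) \<boxtimes> f) \<cdot> shift (ev A) (map ev \<Delta>)))"
  using assms(3)
proof (induction W \<equiv> "tspine \<Gamma> (Ten A Z)" B g arbitrary: \<Gamma> A rule: derivable.induct)
  note f_arr = derivable_arr[OF f]
  case (ident \<Gamma> A)
  have "derivable (tspine \<Delta> A) (Ten A Z) ((Ident C (ev A) \<boxtimes> f) \<cdot> shift (ev A) (map ev \<Delta>))"
    by (rule tensor[OF derivable.ident f])
  from derivable_spineA[OF this, of \<Gamma>] show ?case
    using f_arr by simp
next
  note f_arr = derivable_arr[OF f]
  case (passivate \<Phi> Y B g \<Gamma> A)
  note g_arr = derivable_arr[OF passivate(1)]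
  obtain \<Theta> where \<Theta>: "\<Phi> = \<Gamma> @ \<Theta>" "Ten A Z = tspine \<Theta> (Ten Uni Y)"
    using passivate(3)
  proof (cases rule: tspine_eq_tspine)
    \<comment> \<open>\<open>Ten A Z\<close> cannot lie properly inside \<open>Ten Uni Y\<close> on
      the left spine, as the left factor there is a leaf.\<close>
    case (2 \<Theta>)
    then show ?thesis using that[of "[]"] by (cases \<Theta>) (auto elim: Uni_eq_tspine)
  qed
  show ?case
  proof (cases \<Theta>)
    \<comment> \<open>The passivated entry is the cut formula itself: \<lambda> cancels
      \<open>shift\<close>, and a stoup cut remains.\<close>
    case Nil
    then have [simp]: "\<Phi> = \<Gamma>" "A = Uni" "Y = Z" using \<Theta> by auto
    have "LUnit C (ev Z) \<cdot> (Ident C (Unit C) \<boxtimes> f) \<cdot> shift (Unit C) (map ev \<Delta>)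
        = (LUnit C (ev Z) \<cdot> (Ident C (Unit C) \<boxtimes> f)) \<cdot> shift (Unit C) (map ev \<Delta>)"
      using f_arr by (simp add: Comp_assoc_arr)
    also have "\<dots> = f \<cdot> LUnit C (spine (map ev \<Delta>) (Unit C)) \<cdot> shift (Unit C) (map ev \<Delta>)"
      using f_arr by (simp add: LUnit_natural_arr Comp_assoc_arr)
    also have "\<dots> = f"
      using f_arr by (simp add: LUnit_shift)
    finally have "(g \<cdot> spineA (map ev \<Gamma>) (LUnit C (ev Z)))
        \<cdot> spineA (map ev \<Gamma>) ((Ident C (Unit C) \<boxtimes> f) \<cdot> shift (Unit C) (map ev \<Delta>))
      = g \<cdot> spineA (map ev \<Gamma>) f"
      using f_arr g_arr by (simp add: Comp_assoc_arr spineA_Comp[symmetric])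
    then show ?thesis using stoup[of \<Gamma> B g] passivate(1) by simp
  next
    case (Cons Z' \<Theta>')
    then have [simp]: "\<Phi> = \<Gamma> @ Z # \<Theta>'" "A = tspine \<Theta>' (Ten Uni Y)" using \<Theta> by auto
    let ?l = "LUnit C (ev Y)"
    let ?s = "\<lambda>A. (Ident C A \<boxtimes> f) \<cdot> shift A (map ev \<Delta>)"
    have IH: "derivable (tspine \<Gamma> (tspine \<Delta> (tspine \<Theta>' Y))) B
      (g \<cdot> spineA (map ev \<Gamma>) (?s (ev (tspine \<Theta>' Y))))"
      using passivate(2)[of \<Gamma> "tspine \<Theta>' Y"] by (simp add: tspine_append)
    define k where "k = spineA (map ev \<Theta>') ?l"
    have k: "k \<in> Arr C" "Dom C k = spine (map ev \<Theta>') (Unit C \<otimes> ev Y)"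
      "Cod C k = spine (map ev \<Theta>') (ev Y)"
      by (auto simp: k_def)
    have "(k \<boxtimes> Ident C (ev Z)) \<cdot> ?s (Dom C k) = ?s (Cod C k) \<cdot> spineA (map ev \<Delta>) k"
      using f_arr k shift_natural[of "map ev \<Delta>" k]
      by (simp add: Comp_assoc_arr interchange_Comp)
    then show ?thesis
      using f_arr g_arr k
      by (intro passivate'[OF IH, where \<Gamma> = "\<Gamma> @ \<Delta> @ \<Theta>'" and Y = Y])
        (auto simp: tspine_append spine_append spineA_append k_def[symmetric]
          Comp_assoc_arr spineA_Comp[symmetric])
  qed
next
  note f_arr = derivable_arr[OF f]
  case (tensor D B g \<Psi> Y h \<Gamma> A)
  note g_arr = derivable_arr[OF tensor(1)] and h_arr = derivable_arr[OF tensor(3)]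
  let ?s = "\<lambda>A. (Ident C A \<boxtimes> f) \<cdot> shift A (map ev \<Delta>)"
  consider \<Gamma>' where "\<Gamma> = \<Psi> @ \<Gamma>'" "D = tspine \<Gamma>' (Ten A Z)"
    | \<Psi>' where "\<Psi> = \<Gamma> @ Z # \<Psi>'" "A = tspine \<Psi>' D"
    using tensor(5)
  proof (cases rule: tspine_eq_tspine)
    case (1 \<Theta>)
    then show ?thesis using that(1)[of "[]"] that(2) by (cases \<Theta>) auto
  qed
  then show ?case
  proof cases
    case 1
    define k where "k = spineA (map ev \<Gamma>') (?s (ev A))"
    have k: "k \<in> Arr C" "Dom C k = ev (tspine \<Gamma>' (tspine \<Delta> A))" "Cod C k = ev D"
      using f_arr 1 by (auto simp: k_def)
    show ?thesis
      using f_arr g_arr h_arr k shift_natural[of "map ev \<Psi>" k]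
      by (intro tensor'[OF tensor(2)[OF 1(2)] tensor(3), where \<Delta> = \<Psi>])
        (auto simp: 1(1) tspine_append spineA_append k_def[symmetric] Comp_assoc_arr interchange_Comp)
  next
    \<comment> \<open>The cut formula goes to the second premise. There the unit replaces
      \<open>D\<close>, so \<open>A\<close> turns into \<open>tspine \<Psi>' Uni\<close>.\<close>
    case 2
    let ?v = "?s (spine (map ev \<Psi>') (Unit C))"
    have IH: "derivable (tspine \<Gamma> (tspine \<Delta> (tspine \<Psi>' Uni))) Y (h \<cdot> spineA (map ev \<Gamma>) ?v)"
      using tensor(4)[of \<Gamma> "tspine \<Psi>' Uni"] 2 by (simp add: tspine_append)
    have "shift (ev D) (map ev \<Gamma> @ ev Z # map ev \<Psi>') \<cdot> spineA (map ev \<Gamma>) (?s (ev A))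
      = (Ident C (ev D) \<boxtimes> spineA (map ev \<Gamma>) ?v) \<cdot> shift (ev D) (map ev \<Gamma> @ map ev \<Delta> @ map ev \<Psi>')"
      using f_arr 2 shift_slide[of "map ev \<Delta>" "map ev \<Psi>'" "ev D" f]
      by (intro shift_context_natural) (auto simp: hom_def spine_append)
    then show ?thesis
      using f_arr g_arr h_arr 2
      by (intro tensor'[OF tensor(1) IH, where \<Delta> = "\<Gamma> @ \<Delta> @ \<Psi>'"])
        (auto simp: tspine_append spine_append Comp_assoc_arr interchange_Comp)
  qed
qed

text \<open>Induction on the derivation of \<open>f\<close>. For the tensor rule, the second premise
  is cut into the context entry \<open>Z\<close>, with its induction hypothesis serving as
  \<open>stoup\<close>; then the first premise is cut into \<open>B\<close> under the longer context
  \<open>\<Gamma> @ \<Delta>\<close>.\<close>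

lemma derivable_stoup_cut:
  assumes "derivable A B f" "derivable (tspine \<Gamma> B) D g"
  shows "derivable (tspine \<Gamma> A) D (g \<cdot> spineA (map ev \<Gamma>) f)"
  using assms
proof (induction arbitrary: \<Gamma> D g rule: derivable.induct)
  case (ident A)
  then show ?case using derivable_arr[OF ident] by simp
next
  case (passivate \<Phi> Y B f)
  note f_arr = derivable_arr[OF passivate(1)] and g_arr = derivable_arr[OF passivate(3)]
  show ?case
    using f_arr g_arr
    by (intro passivate'[OF passivate(2)[OF passivate(3)], where \<Gamma> = "\<Gamma> @ \<Phi>" and Y = Y])
      (auto simp: tspine_append spineA_append spine_append spineA_Comp Comp_assoc_arr)
next
  case (tensor A B f \<Delta> Z h)
  note f_arr = derivable_arr[OF tensor(1)] and h_arr = derivable_arr[OF tensor(2)]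
    and g_arr = derivable_arr[OF tensor(5)]
  have "derivable (tspine \<Gamma> (tspine \<Delta> B)) D
      (g \<cdot> spineA (map ev \<Gamma>) ((Ident C (ev B) \<boxtimes> h) \<cdot> shift (ev B) (map ev \<Delta>)))"
    by (rule derivable_context_cut[OF tensor(2,4,5)])
  then have "derivable (tspine (\<Gamma> @ \<Delta>) A) D
      ((g \<cdot> spineA (map ev \<Gamma>) ((Ident C (ev B) \<boxtimes> h) \<cdot> shift (ev B) (map ev \<Delta>)))
        \<cdot> spineA (map ev (\<Gamma> @ \<Delta>)) f)"
    by (intro tensor(3)) (simp add: tspine_append)
  also have "(g \<cdot> spineA (map ev \<Gamma>) ((Ident C (ev B) \<boxtimes> h) \<cdot> shift (ev B) (map ev \<Delta>)))
        \<cdot> spineA (map ev (\<Gamma> @ \<Delta>)) f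
      = g \<cdot> spineA (map ev \<Gamma>) ((f \<boxtimes> h) \<cdot> shift (ev A) (map ev \<Delta>))"
    using f_arr g_arr h_arr shift_natural[of "map ev \<Delta>" f]
    by (simp add: spineA_append Comp_assoc_arr spineA_Comp[symmetric] interchange_Comp)
  finally show ?case by (simp add: tspine_append)
qed

lemma derivable_Comp:
  "derivable A B f \<Longrightarrow> derivable B D g \<Longrightarrow> derivable A D (g \<cdot> f)"
  using derivable_stoup_cut[of A B f "[]"] by simp

end

section \<open>Derivations are determined by their image in \<open>\<Delta>\<^sub>\<bottom>\<close>\<close>

lemma Arr_Delta_botE:
  assumes "a \<in> Arr Delta_bot"
  obtains m n \<xi> where "a = (m, n, \<xi>)" "1 \<le> m" "1 \<le> n" "\<xi> \<in> {..<m} \<rightarrow>\<^sub>E {..<n}" "\<xi> 0 = 0"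
  using assms by (auto simp: Delta_bot_def)

locale functor_to_Delta_bot =
  pointed_skew_monoidal_category C X + structure_preserving_functor C Delta_bot P
  for C :: "('o, 'a) skew_monoidal" (structure) and X P +
  assumes map_X: "fst P X = 1"
begin

section \<open>Underlying functions of the structural arrows\<close>

definition und :: "'a \<Rightarrow> nat \<Rightarrow> nat" where
  "und f = snd (snd (snd P f))"

lemma map_arr_cases:
  assumes "f \<in> Arr C"
  obtains \<xi> where "snd P f = (fst P (Dom C f), fst P (Cod C f), \<xi>)"
    "\<xi> \<in> {..<fst P (Dom C f)} \<rightarrow>\<^sub>E {..<fst P (Cod C f)}" "\<xi> 0 = 0"
proof -
  have "snd P f \<in> Arr Delta_bot" using arr_map assms by (rule PiE_mem)
  then obtain m n \<xi> where *: "snd P f = (m, n, \<xi>)" "\<xi> \<in> {..<m} \<rightarrow>\<^sub>E {..<n}" "\<xi> 0 = 0"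
    by (rule Arr_Delta_botE)
  with map_Dom[OF assms] map_Cod[OF assms] have "m = fst P (Dom C f)" "n = fst P (Cod C f)"
    by (simp_all add: Delta_bot_sel)
  with * that show ?thesis by blast
qed

lemma map_arr: "f \<in> Arr C \<Longrightarrow> snd P f = (fst P (Dom C f), fst P (Cod C f), und f)"
  by (erule map_arr_cases) (simp add: und_def)

lemma map_obj_pos: "A \<in> Obj C \<Longrightarrow> 1 \<le> fst P A"
  using PiE_mem[OF obj_map] by (simp add: Delta_bot_sel)

lemma und_lt: "f \<in> Arr C \<Longrightarrow> i < fst P (Dom C f) \<Longrightarrow> und f i < fst P (Cod C f)"
  by (erule map_arr_cases) (simp add: und_def PiE_lt)

lemma und_0: "f \<in> Arr C \<Longrightarrow> und f 0 = 0"
  by (erule map_arr_cases) (simp add: und_def)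

lemma und_Comp:
  assumes "f \<in> Arr C" "g \<in> Arr C" "Dom C g = Cod C f" "i < fst P (Dom C f)"
  shows "und (g \<cdot> f) i = und g (und f i)"
  using map_Comp[OF assms(1-3)] assms
  by (simp add: map_arr Delta_bot_sel compose_def)

lemma und_Ident: "A \<in> Obj C \<Longrightarrow> i < fst P A \<Longrightarrow> und (Ident C A) i = i"
  using map_Ident[of A] by (simp add: map_arr Delta_bot_sel)

lemma und_TensorA:
  assumes "f \<in> Arr C" "g \<in> Arr C" "i < fst P (Dom C f) + fst P (Dom C g)"
  shows "und (f \<boxtimes> g) i = (if i < fst P (Dom C f) then und f i
    else fst P (Cod C f) + und g (i - fst P (Dom C f)))"
  using map_TensorA[OF assms(1,2)] assms by (simp add: map_arr Delta_bot_sel)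

lemma map_obj_TensorO [simp]: "A \<in> Obj C \<Longrightarrow> B \<in> Obj C \<Longrightarrow> fst P (A \<otimes> B) = fst P A + fst P B"
  by (simp add: map_TensorO Delta_bot_sel)

lemma map_obj_Unit [simp]: "fst P (Unit C) = 1"
  by (simp add: map_Unit Delta_bot_sel)

lemma und_LUnit: "A \<in> Obj C \<Longrightarrow> i < Suc (fst P A) \<Longrightarrow> und (LUnit C A) i = i - 1"
  using map_LUnit[of A] by (simp add: map_arr Delta_bot_sel)

lemma und_RUnit: "A \<in> Obj C \<Longrightarrow> i < fst P A \<Longrightarrow> und (RUnit C A) i = i"
  using map_RUnit[of A] by (simp add: map_arr Delta_bot_sel)

lemma und_Assoc: "A \<in> Obj C \<Longrightarrow> B \<in> Obj C \<Longrightarrow> D \<in> Obj C \<Longrightarrow> i < fst P A + fst P B + fst P D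
    \<Longrightarrow> und (Assoc C A B D) i = i"
  using map_Assoc[of A B D] by (simp add: map_arr Delta_bot_sel)

lemma map_obj_spine:
  "set \<Gamma> \<subseteq> Obj C \<Longrightarrow> A \<in> Obj C \<Longrightarrow> fst P (spine \<Gamma> A) = fst P A + sum_list (map (fst P) \<Gamma>)"
  by (induction \<Gamma>) auto

text \<open>Truncated subtraction sends both 0 and 1 to 0, as \<lambda> does; the entries outside
  move down by one.\<close>

lemma und_spineA_LUnit:
  "set \<Gamma> \<subseteq> Obj C \<Longrightarrow> Y \<in> Obj C \<Longrightarrow> i < Suc (fst P (spine \<Gamma> Y))
    \<Longrightarrow> und (spineA \<Gamma> (LUnit C Y)) i = i - 1"
proof (induction \<Gamma>)
  case Nil
  then show ?case by (simp add: und_LUnit)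
next
  case (Cons Z \<Gamma>)
  have "1 \<le> fst P Y" using Cons.prems(2) by (rule map_obj_pos)
  then show ?case using Cons
    by (auto simp: und_TensorA und_Ident map_obj_spine)
qed

text \<open>The omitted value \<open>fst P A\<close> is the position of the unit that \<rho>
  inserts; each \<alpha> acts as the identity.\<close>

lemma und_shift:
  "set \<Delta> \<subseteq> Obj C \<Longrightarrow> A \<in> Obj C \<Longrightarrow> i < fst P (spine \<Delta> A)
    \<Longrightarrow> und (shift A \<Delta>) i = (if i < fst P A then i else Suc i)"
proof (induction \<Delta>)
  case Nil
  then show ?case by (simp add: und_RUnit)
next
  case (Cons Z \<Delta>)
  have *: "set \<Delta> \<subseteq> Obj C" "Z \<in> Obj C" "A \<in> Obj C" using Cons.prems by auto
  have "und (shift A \<Delta> \<boxtimes> Ident C Z) i = (if i < fst P A then i else Suc i)"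
    using Cons * by (auto simp: und_TensorA und_Ident map_obj_spine)
  then show ?case
    using Cons.prems(3) * by (auto simp: und_Comp und_Assoc map_obj_spine)
qed

lemma map_obj_ev [simp]: "fst P (ev A) = leaves A"
  by (induction A) (auto simp: map_X)

lemma map_obj_comp_ev [simp]: "fst P \<circ> ev = leaves"
  by (simp add: fun_eq_iff)

lemma und_passivate:
  assumes "derivable (tspine \<Gamma> Y) B f" "i < Suc (leaves (tspine \<Gamma> Y))"
  shows "und (f \<cdot> spineA (map ev \<Gamma>) (LUnit C (ev Y))) i = und f (i - 1)"
  using derivable_arr[OF assms(1)] assms(2)
  by (simp add: und_Comp und_spineA_LUnit map_obj_spine leaves_tspine)

text \<open>Position 0 of the second premise is the inserted unit, so the first element after
  \<open>A\<close> has index 1 there; hence \<open>Suc i\<close>.\<close>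

lemma und_tensor:
  assumes "derivable A B f" "derivable (tspine \<Delta> Uni) Z g" "i < leaves (tspine \<Delta> A)"
  shows "und ((f \<boxtimes> g) \<cdot> shift (ev A) (map ev \<Delta>)) i
    = (if i < leaves A then und f i else leaves B + und g (Suc i - leaves A))"
  using derivable_arr[OF assms(1)] derivable_arr[OF assms(2)] assms(3)
  by (auto simp: und_Comp und_shift und_TensorA map_obj_spine leaves_tspine)

text \<open>An identity keeps 0 and 1 apart, and a tensor rule that splits directly after
  \<open>Uni\<close> sends 1 into the second summand. Any other tensor rule keeps
  \<open>Ten Uni Y\<close> in its first premise, where the induction hypothesis applies; naturality
  of \<open>shift\<close> then moves \<lambda> outwards.\<close>

lemma derivable_passivate_inv:
  assumes "derivable W B h" "W = tspine \<Gamma> (Ten Uni Y)" "und h 1 = 0"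
  obtains f where "derivable (tspine \<Gamma> Y) B f" "h = f \<cdot> spineA (map ev \<Gamma>) (LUnit C (ev Y))"
  using assms
proof (induction arbitrary: \<Gamma> thesis rule: derivable.induct)
  case (ident A)
  have "1 < leaves A" using leaves_pos[of Y] by (simp add: ident leaves_tspine)
  then show ?case using ident(3) by (simp add: und_Ident)
next
  case (passivate \<Phi> Y' B f)
  \<comment> \<open>A factor \<open>Ten Uni Y\<close> on the left spine sits at its inner end, so
    its position is unique.\<close>
  from passivate(4) have "\<Phi> = \<Gamma> \<and> Y' = Y"
  proof (cases rule: tspine_eq_tspine)
    case (1 \<Theta>) then show ?thesis by (cases \<Theta>) auto
  next
    case (2 \<Theta>) then show ?thesis by (cases \<Theta>) auto
  qed
  then show ?case using passivate(1,3) by blast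
next
  case (tensor A B f \<Delta> Z g)
  note f_arr = derivable_arr[OF tensor(1)] and g_arr = derivable_arr[OF tensor(2)]
  have len: "1 < leaves (tspine \<Delta> A)"
    using leaves_pos[of Y] by (simp add: tensor leaves_tspine)
  have "A \<noteq> Uni"
    using tensor(7) und_tensor[OF tensor(1,2) len] leaves_pos[of B] by auto
  then obtain \<Theta> where \<Theta>: "\<Gamma> = \<Delta> @ \<Theta>" "A = tspine \<Theta> (Ten Uni Y)"
    using tensor(6)[symmetric]
  proof (elim tspine_eq_tspine)
    fix \<Theta> assume "\<Delta> = \<Gamma> @ \<Theta>" "Ten Uni Y = tspine \<Theta> A"
    then show ?thesis using that[of "[]"] \<open>A \<noteq> Uni\<close> by (cases \<Theta>) auto
  qed
  have "1 < leaves A"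
    using leaves_pos[of Y] by (simp add: \<Theta> leaves_tspine)
  then have "und f 1 = 0"
    using tensor(7) und_tensor[OF tensor(1,2) len] by simp
  with tensor(3) \<Theta>(2) obtain f' where
    f': "derivable (tspine \<Theta> Y) B f'" "f = f' \<cdot> spineA (map ev \<Theta>) (LUnit C (ev Y))" by blast
  define k where "k = spineA (map ev \<Theta>) (LUnit C (ev Y))"
  have k: "k \<in> Arr C" "Dom C k = ev A" "Cod C k = ev (tspine \<Theta> Y)"
    by (auto simp: k_def \<Theta>)
  have "(f \<boxtimes> g) \<cdot> shift (ev A) (map ev \<Delta>)
    = ((f' \<boxtimes> g) \<cdot> shift (ev (tspine \<Theta> Y)) (map ev \<Delta>)) \<cdot> spineA (map ev \<Gamma>) (LUnit C (ev Y))"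
    using k derivable_arr[OF f'(1)] g_arr shift_natural[of "map ev \<Delta>" k]
    by (simp add: f'(2) \<Theta>(1) spineA_append k_def[symmetric] Comp_assoc_arr interchange_Comp)
  then show ?case
    using derivable.tensor[OF f'(1) tensor(2)] tensor(5) by (simp add: \<Theta>(1) tspine_append)
qed

text \<open>A final passivation would give \<open>und h 1 = und f 0 = 0\<close>. An identity on a
  tensor is turned into an instance of the tensor rule by \<open>tensor_eq\<close>.\<close>

lemma derivable_tensor_inv:
  assumes "derivable A (Ten B Z) h" "\<And>\<Gamma> Y. A = tspine \<Gamma> (Ten Uni Y) \<Longrightarrow> und h 1 \<noteq> 0"
  obtains D \<Delta> f g where "A = tspine \<Delta> D" "derivable D B f" "derivable (tspine \<Delta> Uni) Z g"
    "h = (f \<boxtimes> g) \<cdot> shift (ev D) (map ev \<Delta>)"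
  using assms(1)
proof cases
  case ident
  have "h = (Ident C (ev B) \<boxtimes> LUnit C (ev Z)) \<cdot> shift (ev B) (map ev [Z])"
    using tensor_eq[of "Ident C (ev B)" "Ident C (ev Z)"] by (simp add: ident(2) ident(1)[symmetric])
  then show ?thesis
    using that[of "[Z]" B "Ident C (ev B)" "LUnit C (ev Z)"] ident(1) derivable.ident derivable_LUnit
    by simp
next
  case (passivate \<Gamma> Y f)
  then show ?thesis
    using assms(2)[of \<Gamma> Y] und_passivate[OF passivate(3), of 1] und_0[of f] derivable_arr[OF passivate(3)]
    by (simp add: leaves_tspine)
next
  case (tensor D f \<Delta> g)
  then show ?thesis using that by blast
qed

lemma derivable_leaf_inv:
  assumes "derivable A B h" "\<And>\<Gamma> Y. A = tspine \<Gamma> (Ten Uni Y) \<Longrightarrow> und h 1 \<noteq> 0"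
    "\<And>D Z. B \<noteq> Ten D Z"
  shows "h = Ident C (ev B)"
  using assms(1)
proof cases
  case (passivate \<Gamma> Y f)
  then show ?thesis
    using assms(2)[of \<Gamma> Y] und_passivate[OF passivate(3), of 1] und_0[of f] derivable_arr[OF passivate(3)]
    by (simp add: leaves_tspine)
qed (use assms(3) in auto)

text \<open>The measure drops: undoing passivation removes a leaf from the domain, while undoing the
  tensor rule passes to a proper factor of the codomain and never enlarges the number of leaves of
  the domain.\<close>

lemma derivable_unique:
  assumes "derivable A B f" "derivable A B g" "\<And>i. i < leaves A \<Longrightarrow> und f i = und g i"
  shows "f = g"
  using assms
proof (induction "leaves A + leaves B" arbitrary: A B f g rule: less_induct)
  case less
  show ?case
  proof (cases "\<exists>\<Gamma> Y. A = tspine \<Gamma> (Ten Uni Y) \<and> und f 1 = 0")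
    case True
    then obtain \<Gamma> Y where A: "A = tspine \<Gamma> (Ten Uni Y)" and f1: "und f 1 = 0" by blast
    have leaves_A: "leaves A = Suc (leaves (tspine \<Gamma> Y))" by (simp add: A leaves_tspine)
    then have g1: "und g 1 = 0" using less(4)[of 1] f1 by simp
    obtain f' where f': "derivable (tspine \<Gamma> Y) B f'"
      "f = f' \<cdot> spineA (map ev \<Gamma>) (LUnit C (ev Y))"
      using derivable_passivate_inv[OF less(2) A f1] .
    obtain g' where g': "derivable (tspine \<Gamma> Y) B g'"
      "g = g' \<cdot> spineA (map ev \<Gamma>) (LUnit C (ev Y))"
      using derivable_passivate_inv[OF less(3) A g1] .
    have "f' = g'"
    proof (rule less(1)[OF _ f'(1) g'(1)])
      fix i assume "i < leaves (tspine \<Gamma> Y)"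
      then show "und f' i = und g' i"
        using less(4)[of "Suc i"] und_passivate[OF f'(1), of "Suc i"] und_passivate[OF g'(1), of "Suc i"]
        by (simp add: leaves_A f'(2) g'(2))
    qed (simp add: leaves_A)
    then show ?thesis by (simp add: f' g')
  next
    case False
    then have f_inv: "und f 1 \<noteq> 0" and g_inv: "und g 1 \<noteq> 0"
      if "A = tspine \<Gamma> (Ten Uni Y)" for \<Gamma> Y
      using that less(4)[of 1] leaves_pos[of Y] by (auto simp: leaves_tspine)
    show ?thesis
    proof (cases "\<exists>D Z. B = Ten D Z")
      case True
      then obtain B' Z where B: "B = Ten B' Z" by blast
      obtain D \<Delta> f1 f2 where f: "A = tspine \<Delta> D" "derivable D B' f1" "derivable (tspine \<Delta> Uni) Z f2"
        "f = (f1 \<boxtimes> f2) \<cdot> shift (ev D) (map ev \<Delta>)"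
        using derivable_tensor_inv[OF less(2)[unfolded B] f_inv] .
      obtain D' \<Delta>' g1 g2 where
        g: "A = tspine \<Delta>' D'" "derivable D' B' g1" "derivable (tspine \<Delta>' Uni) Z g2"
        "g = (g1 \<boxtimes> g2) \<cdot> shift (ev D') (map ev \<Delta>')"
        using derivable_tensor_inv[OF less(3)[unfolded B] g_inv] .
      have f_und: "und f i = (if i < leaves D then und f1 i else leaves B' + und f2 (Suc i - leaves D))"
        if "i < leaves A" for i
        using und_tensor[OF f(2,3)] that by (simp add: f(1,4))
      have g_und: "und g i = (if i < leaves D' then und g1 i else leaves B' + und g2 (Suc i - leaves D'))"
        if "i < leaves A" for i
        using und_tensor[OF g(2,3)] that by (simp add: g(1,4))
      have "leaves D \<le> leaves A" "leaves D' \<le> leaves A"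
        using leaves_tspine[of \<Delta> D] leaves_tspine[of \<Delta>' D'] by (simp_all flip: f(1) g(1))
      have f1_lt: "und f1 i < leaves B'" if "i < leaves D" for i
        using und_lt[of f1 i] derivable_arr[OF f(2)] that by simp
      have g1_lt: "und g1 i < leaves B'" if "i < leaves D'" for i
        using und_lt[of g1 i] derivable_arr[OF g(2)] that by simp
      \<comment> \<open>If the split points differed, then at the smaller one, one function would
        already be in the second summand and the other still below \<open>leaves B'\<close>.\<close>
      have "leaves D = leaves D'"
      proof (rule ccontr)
        assume "leaves D \<noteq> leaves D'"
        then consider "leaves D < leaves D'" | "leaves D' < leaves D" by linarith
        then show False
        proof cases
          case 1
          then show False
            using less(4)[of "leaves D"] f_und[of "leaves D"] g_und[of "leaves D"] g1_lt[of "leaves D"]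
              \<open>leaves D' \<le> leaves A\<close> by simp
        next
          case 2
          then show False
            using less(4)[of "leaves D'"] f_und[of "leaves D'"] g_und[of "leaves D'"] f1_lt[of "leaves D'"]
              \<open>leaves D \<le> leaves A\<close> by simp
        qed
      qed
      \<comment> \<open>Every tree has a leaf, so equal leaf counts leave no room for a nonempty
        \<open>\<Theta>\<close>.\<close>
      have "\<Delta>' = \<Delta> \<and> D' = D"
        using f(1)[unfolded g(1)]
      proof (cases rule: tspine_eq_tspine)
        case (1 \<Theta>)
        then show ?thesis using \<open>leaves D = leaves D'\<close> by (cases \<Theta>) (auto simp: leaves_tspine)
      next
        case (2 \<Theta>)
        then show ?thesis using \<open>leaves D = leaves D'\<close> by (cases \<Theta>) (auto simp: leaves_tspine)
      qed
      then have [simp]: "\<Delta>' = \<Delta>" "D' = D" by auto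
      have "f1 = g1"
      proof (rule less(1)[OF _ f(2)])
        show "derivable D B' g1" using g(2) by simp
        show "leaves D + leaves B' < leaves A + leaves B"
          using \<open>leaves D \<le> leaves A\<close> by (simp add: B add_le_less_mono)
        show "und f1 i = und g1 i" if "i < leaves D" for i
          using that less(4)[of i] f_und[of i] g_und[of i] \<open>leaves D \<le> leaves A\<close> by simp
      qed
      moreover have "f2 = g2"
      proof (rule less(1)[OF _ f(3)])
        show "derivable (tspine \<Delta> Uni) Z g2" using g(3) by simp
        show "leaves (tspine \<Delta> Uni) + leaves Z < leaves A + leaves B"
          using leaves_pos[of D] leaves_pos[of B'] by (simp add: B f(1) leaves_tspine del: leaves_pos)
        show "und f2 i = und g2 i" if "i < leaves (tspine \<Delta> Uni)" for i
        proof (cases i)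
          \<comment> \<open>No position of \<open>A\<close> corresponds to the inserted unit; here
            agreement comes from preservation of 0.\<close>
          case 0
          then show ?thesis
            using und_0[of f2] und_0[of g2] derivable_arr[OF f(3)] derivable_arr[OF g(3)] by simp
        next
          case (Suc j)
          then have "leaves D + j < leaves A" using that by (simp add: f(1) leaves_tspine)
          then show ?thesis
            using less(4)[of "leaves D + j"] f_und[of "leaves D + j"] g_und[of "leaves D + j"] Suc
            by simp
        qed
      qed
      ultimately show ?thesis by (simp add: f g)
    next
      case False
      have "f = Ident C (ev B)"
        by (rule derivable_leaf_inv[OF less(2)]) (use False f_inv in blast)+
      moreover have "g = Ident C (ev B)"
        by (rule derivable_leaf_inv[OF less(3)]) (use False g_inv in blast)+
      ultimately show ?thesis by simp
    qed
  qed
qed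

end

section \<open>The free skew monoidal category\<close>

lemma structure_preserving_functor_ext:
  assumes "structure_preserving_functor C D P" "structure_preserving_functor C D Q"
    and "\<And>A. A \<in> Obj C \<Longrightarrow> fst P A = fst Q A" "\<And>f. f \<in> Arr C \<Longrightarrow> snd P f = snd Q f"
  shows "P = Q"
proof (rule prod_eqI)
  interpret P: structure_preserving_functor C D P by fact
  interpret Q: structure_preserving_functor C D Q by fact
  show "fst P = fst Q" by (rule PiE_ext[OF P.obj_map Q.obj_map assms(3)])
  show "snd P = snd Q" by (rule PiE_ext[OF P.arr_map Q.arr_map assms(4)])
qed

lemma structure_preserving_functor_compose:
  assumes "skew_monoidal_category C"
    and "structure_preserving_functor C D P" "structure_preserving_functor D E Q"
  shows "structure_preserving_functor C E (compose (Obj C) (fst Q) (fst P), compose (Arr C) (snd Q) (snd P))"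
proof -
  interpret skew_monoidal_category C by fact
  interpret P: structure_preserving_functor C D P by fact
  interpret Q: structure_preserving_functor D E Q by fact
  have [simp]: "fst P A \<in> Obj D" if "A \<in> Obj C" for A using P.obj_map that by (rule PiE_mem)
  have [simp]: "snd P f \<in> Arr D" if "f \<in> Arr C" for f using P.arr_map that by (rule PiE_mem)
  have [simp]: "fst Q A \<in> Obj E" if "A \<in> Obj D" for A using Q.obj_map that by (rule PiE_mem)
  have [simp]: "snd Q f \<in> Arr E" if "f \<in> Arr D" for f using Q.arr_map that by (rule PiE_mem)
  show ?thesis
    by unfold_locales
      (auto simp: compose_def P.map_Dom P.map_Cod P.map_Ident P.map_Comp P.map_Unit P.map_TensorO
        P.map_TensorA P.map_Assoc P.map_LUnit P.map_RUnit Q.map_Dom Q.map_Cod Q.map_Ident Q.map_Comp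
        Q.map_Unit Q.map_TensorO Q.map_TensorA Q.map_Assoc Q.map_LUnit Q.map_RUnit)
qed

text \<open>Brings a category onto the types over which freeness quantifies. Arguments are pulled
  back by \<open>inv_into\<close>, so injectivity on the carriers suffices for an isomorphic
  copy.\<close>

definition transport :: "('o \<Rightarrow> 'p) \<Rightarrow> ('a \<Rightarrow> 'b) \<Rightarrow> ('o, 'a) skew_monoidal \<Rightarrow> ('p, 'b) skew_monoidal" where
  "transport i j C = (let i' = inv_into (Obj C) i; j' = inv_into (Arr C) j in \<lparr>
     Obj = i ` Obj C,
     Arr = j ` Arr C,
     Dom = (\<lambda>f. i (Dom C (j' f))),
     Cod = (\<lambda>f. i (Cod C (j' f))),
     Ident = (\<lambda>A. j (Ident C (i' A))),
     Comp = (\<lambda>g f. j (Comp C (j' g) (j' f))),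
     TensorO = (\<lambda>A B. i (TensorO C (i' A) (i' B))),
     TensorA = (\<lambda>f g. j (TensorA C (j' f) (j' g))),
     Unit = i (Unit C),
     Assoc = (\<lambda>A B D. j (Assoc C (i' A) (i' B) (i' D))),
     LUnit = (\<lambda>A. j (LUnit C (i' A))),
     RUnit = (\<lambda>A. j (RUnit C (i' A))) \<rparr>)"

context
  fixes C :: "('o, 'a) skew_monoidal" (structure) and i :: "'o \<Rightarrow> 'p" and j :: "'a \<Rightarrow> 'b"
  assumes C: "skew_monoidal_category C" and i: "inj_on i (Obj C)" and j: "inj_on j (Arr C)"
begin

interpretation skew_monoidal_category C by (fact C)

lemma transport_sel:
  "Obj (transport i j C) = i ` Obj C"
  "Arr (transport i j C) = j ` Arr C"
  "f \<in> Arr C \<Longrightarrow> Dom (transport i j C) (j f) = i (Dom C f)"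
  "f \<in> Arr C \<Longrightarrow> Cod (transport i j C) (j f) = i (Cod C f)"
  "A \<in> Obj C \<Longrightarrow> Ident (transport i j C) (i A) = j (Ident C A)"
  "f \<in> Arr C \<Longrightarrow> g \<in> Arr C \<Longrightarrow> j g \<cdot>\<^bsub>transport i j C\<^esub> j f = j (g \<cdot> f)"
  "A \<in> Obj C \<Longrightarrow> B \<in> Obj C \<Longrightarrow> i A \<otimes>\<^bsub>transport i j C\<^esub> i B = i (A \<otimes> B)"
  "f \<in> Arr C \<Longrightarrow> g \<in> Arr C \<Longrightarrow> j g \<boxtimes>\<^bsub>transport i j C\<^esub> j f = j (g \<boxtimes> f)"
  "Unit (transport i j C) = i (Unit C)"
  "A \<in> Obj C \<Longrightarrow> B \<in> Obj C \<Longrightarrow> D \<in> Obj C \<Longrightarrow>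
    Assoc (transport i j C) (i A) (i B) (i D) = j (Assoc C A B D)"
  "A \<in> Obj C \<Longrightarrow> LUnit (transport i j C) (i A) = j (LUnit C A)"
  "A \<in> Obj C \<Longrightarrow> RUnit (transport i j C) (i A) = j (RUnit C A)"
  using i j by (simp_all add: transport_def Let_def)

lemma skew_monoidal_category_transport: "skew_monoidal_category (transport i j C)"
proof -
  note sel = transport_sel hom_def inj_on_eq_iff[OF i] inj_on_eq_iff[OF j]
  show ?thesis
    by unfold_locales
      (auto simp: sel Comp_assoc_arr interchange Assoc_natural_arr LUnit_natural_arr RUnit_natural_arr
        pentagon LUnit_Assoc LUnit_Assoc_RUnit Assoc_RUnit LUnit_RUnit)
qed

lemma structure_preserving_functor_transport:
  "structure_preserving_functor C (transport i j C) (restrict i (Obj C), restrict j (Arr C))"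
  by unfold_locales (auto simp: transport_sel)

lemma structure_preserving_functor_transport_inv:
  "structure_preserving_functor (transport i j C) C
    (restrict (inv_into (Obj C) i) (i ` Obj C), restrict (inv_into (Arr C) j) (j ` Arr C))"
  by unfold_locales (auto simp: transport_sel i j inj_on_eq_iff[OF i] inj_on_eq_iff[OF j])

end

lemma countable_inj_on_infinite:
  assumes "countable S"
  obtains f :: "'a \<Rightarrow> 'b::infinite" where "inj_on f S"
proof -
  obtain e :: "nat \<Rightarrow> 'b" where "inj e"
    using infinite_countable_subset[OF infinite_UNIV] by blast
  then have "inj_on (e \<circ> to_nat_on S) S"
    using assms by (intro comp_inj_on inj_on_to_nat_on) (auto intro: inj_on_subset)
  then show ?thesis by (rule that)
qed

text \<open>Countability supplies injections into the types of \<open>F\<close>. Existence follows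
  by composing with the inverse of the copying isomorphism, uniqueness by composing with the
  isomorphism and cancelling the injections.\<close>

lemma free_skew_monoidal_universal:
  fixes F :: "('o::infinite, 'a::infinite) skew_monoidal" and C :: "('p, 'b) skew_monoidal"
  assumes free: "free_skew_monoidal_on_object F X"
    and C: "skew_monoidal_category C" "countable (Obj C)" "countable (Arr C)" "c \<in> Obj C"
  shows "\<exists>!P. structure_preserving_functor F C P \<and> fst P X = c"
proof -
  have F: "skew_monoidal_category F" and X: "X \<in> Obj F"
    using free by (auto simp: free_skew_monoidal_on_object_def)
  obtain i :: "'p \<Rightarrow> 'o" where i: "inj_on i (Obj C)" using countable_inj_on_infinite[OF C(2)] .
  obtain j :: "'b \<Rightarrow> 'a" where j: "inj_on j (Arr C)" using countable_inj_on_infinite[OF C(3)] .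
  let ?T = "transport i j C"
  note transport = C(1) i j
  have "i c \<in> Obj ?T" using C(4) by (simp add: transport_sel[OF transport])
  then have universal: "\<exists>!P. structure_preserving_functor F ?T P \<and> fst P X = i c"
    using free skew_monoidal_category_transport[OF transport]
    by (simp add: free_skew_monoidal_on_object_def)
  then obtain P where P: "structure_preserving_functor F ?T P" "fst P X = i c" by blast
  define J where "J = (restrict i (Obj C), restrict j (Arr C))"
  define J' where "J' = (restrict (inv_into (Obj C) i) (i ` Obj C), restrict (inv_into (Arr C) j) (j ` Arr C))"
  have J: "structure_preserving_functor C ?T J"
    unfolding J_def by (rule structure_preserving_functor_transport[OF transport])
  have J': "structure_preserving_functor ?T C J'"
    unfolding J'_def by (rule structure_preserving_functor_transport_inv[OF transport])
  show ?thesis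
  proof (rule ex_ex1I)
    show "\<exists>P. structure_preserving_functor F C P \<and> fst P X = c"
      using structure_preserving_functor_compose[OF F P(1) J'] C(4) X P(2) i
      by (intro exI conjI) (auto simp: compose_def J'_def)
  next
    fix P Q
    assume P: "structure_preserving_functor F C P \<and> fst P X = c"
      and Q: "structure_preserving_functor F C Q \<and> fst Q X = c"
    then interpret P: structure_preserving_functor F C P + Q: structure_preserving_functor F C Q
      by auto
    let ?JP = "(compose (Obj F) (fst J) (fst P), compose (Arr F) (snd J) (snd P))"
    let ?JQ = "(compose (Obj F) (fst J) (fst Q), compose (Arr F) (snd J) (snd Q))"
    have "structure_preserving_functor F ?T ?JP \<and> fst ?JP X = i c"
      "structure_preserving_functor F ?T ?JQ \<and> fst ?JQ X = i c"
      using structure_preserving_functor_compose[OF F _ J, of P]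
        structure_preserving_functor_compose[OF F _ J, of Q] P Q X C(4)
      by (auto simp: compose_def J_def)
    with universal have "?JP = ?JQ" by blast
    then have *: "compose (Obj F) (fst J) (fst P) A = compose (Obj F) (fst J) (fst Q) A"
      "compose (Arr F) (snd J) (snd P) f = compose (Arr F) (snd J) (snd Q) f" for A f
      by (simp_all add: prod_eq_iff)
    show "P = Q"
    proof (rule structure_preserving_functor_ext)
      show "fst P A = fst Q A" if "A \<in> Obj F" for A
        using *(1)[of A] that PiE_mem[OF P.obj_map that] PiE_mem[OF Q.obj_map that]
        by (simp add: compose_def J_def inj_on_eq_iff[OF i])
      show "snd P f = snd Q f" if "f \<in> Arr F" for f
        using *(2)[of f] that PiE_mem[OF P.arr_map that] PiE_mem[OF Q.arr_map that]
        by (simp add: compose_def J_def inj_on_eq_iff[OF j])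
    qed (use P Q in auto)
  qed
qed

text \<open>Any two trees are joined by exactly one arrow, so every diagram commutes and the tensor
  of objects may be the free operation \<open>Ten\<close>.\<close>

definition chaotic :: "(tree, tree \<times> tree) skew_monoidal" where
  "chaotic = \<lparr>
     Obj = UNIV,
     Arr = UNIV,
     Dom = fst,
     Cod = snd,
     Ident = (\<lambda>A. (A, A)),
     Comp = (\<lambda>g f. (fst f, snd g)),
     TensorO = Ten,
     TensorA = (\<lambda>f g. (Ten (fst f) (fst g), Ten (snd f) (snd g))),
     Unit = Uni,
     Assoc = (\<lambda>A B D. (Ten (Ten A B) D, Ten A (Ten B D))),
     LUnit = (\<lambda>A. (Ten Uni A, A)),
     RUnit = (\<lambda>A. (A, Ten A Uni)) \<rparr>"

lemma skew_monoidal_category_chaotic: "skew_monoidal_category chaotic"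
  by unfold_locales (auto simp: chaotic_def hom_def)

text \<open>A functor to the chaotic category on the trees tells the objects \<open>ev A\<close> apart.\<close>

lemma inj_ev_free:
  fixes F :: "('o::infinite, 'a::infinite) skew_monoidal"
  assumes free: "free_skew_monoidal_on_object F X" and "pointed_skew_monoidal_category F X"
  shows "inj (pointed_skew_monoidal_category.ev F X)"
proof -
  interpret pointed_skew_monoidal_category F X by fact
  have "\<exists>!P. structure_preserving_functor F chaotic P \<and> fst P X = Gen"
    by (rule free_skew_monoidal_universal[OF free skew_monoidal_category_chaotic])
      (auto simp: chaotic_def)
  then obtain P where "structure_preserving_functor F chaotic P" and X: "fst P X = Gen" by blast
  then interpret P: structure_preserving_functor F chaotic P by simp
  have "fst P (ev A) = A" for A
    by (induction A) (simp_all add: X P.map_Unit P.map_TensorO chaotic_def)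
  then show ?thesis by (rule inj_on_inverseI)
qed

lemma structure_preserving_functor_id:
  "skew_monoidal_category C \<Longrightarrow>
    structure_preserving_functor C C (restrict id (Obj C), restrict id (Arr C))"
proof -
  assume "skew_monoidal_category C"
  then interpret skew_monoidal_category C .
  show ?thesis by unfold_locales auto
qed

section \<open>The subcategory of derivable arrows\<close>

context pointed_skew_monoidal_category
begin

definition derivables :: "'a set" where
  "derivables = {f. \<exists>A B. derivable A B f}"

lemma derivablesI: "derivable A B f \<Longrightarrow> f \<in> derivables"
  by (auto simp: derivables_def)

lemma derivables_Arr: "f \<in> derivables \<Longrightarrow> f \<in> Arr C"
  by (auto simp: derivables_def dest: derivable_arr)

text \<open>Composable arrows share an object, whereas cut needs a shared tree; injectivity of
  \<open>ev\<close> closes this gap.\<close>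

lemma derivables_Comp:
  assumes "inj ev" "f \<in> derivables" "g \<in> derivables" "Dom C g = Cod C f"
  shows "g \<cdot> f \<in> derivables"
proof -
  obtain A B A' B' where "derivable A B f" "derivable A' B' g"
    using assms by (auto simp: derivables_def)
  moreover from this have "B = A'"
    using assms by (auto dest!: derivable_arr dest: injD)
  ultimately show ?thesis by (auto intro: derivablesI derivable_Comp)
qed

lemma derivables_TensorA: "f \<in> derivables \<Longrightarrow> g \<in> derivables \<Longrightarrow> f \<boxtimes> g \<in> derivables"
  by (auto simp: derivables_def intro: derivable_TensorA)

end

text \<open>The derivable arrows form a skew monoidal subcategory.  The functor into it given by freeness
  is the identity when followed by the inclusion, so nothing lies outside.\<close>

lemma derivables_free:
  fixes F :: "('o::infinite, 'a::infinite) skew_monoidal"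
  assumes free: "free_skew_monoidal_on_object F X" and "pointed_skew_monoidal_category F X"
  shows "Arr F = pointed_skew_monoidal_category.derivables F X"
proof -
  interpret pointed_skew_monoidal_category F X by fact
  have inj: "inj ev" by (rule inj_ev_free[OF assms])
  have F: "skew_monoidal_category F" by unfold_locales
  \<comment> \<open>The objects are cut down as well, since identities and constraints are known to
    be derivable only at objects \<open>ev A\<close>.\<close>
  let ?G = "F\<lparr>Obj := range ev, Arr := derivables\<rparr>"
  have [simp]: "A \<in> range ev \<Longrightarrow> A \<in> Obj F" for A by auto
  have range_TensorO [simp]: "A \<otimes>\<^bsub>F\<^esub> B \<in> range ev" if "A \<in> range ev" "B \<in> range ev" for A B
    using that by (auto simp flip: ev.simps(3))
  have range_Unit [simp]: "Unit F \<in> range ev"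
    using rangeI[of ev Uni] by simp
  have range_Dom_Cod: "Dom F f \<in> range ev" "Cod F f \<in> range ev" if "f \<in> derivables" for f
    using that by (auto simp: derivables_def dest!: derivable_arr)
  have derivables_Ident: "Ident F A \<in> derivables" if "A \<in> range ev" for A
    using that by (auto intro: derivablesI[OF ident])
  have derivables_Assoc: "Assoc F A B D \<in> derivables"
    if "A \<in> range ev" "B \<in> range ev" "D \<in> range ev" for A B D
    using that by (auto intro: derivablesI[OF derivable_Assoc])
  have derivables_LUnit: "LUnit F A \<in> derivables" and derivables_RUnit: "RUnit F A \<in> derivables"
    if "A \<in> range ev" for A
    using that by (auto intro: derivablesI[OF derivable_LUnit] derivablesI[OF derivable_RUnit])
  note in_G = range_Dom_Cod derivables_Ident derivables_Assoc derivables_LUnit derivables_RUnit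
    derivables_Comp[OF inj] derivables_TensorA
  have G: "skew_monoidal_category ?G"
    by unfold_locales
      (auto simp: hom_def in_G derivables_Arr Comp_assoc_arr interchange Assoc_natural_arr
        LUnit_natural_arr RUnit_natural_arr pentagon LUnit_Assoc LUnit_Assoc_RUnit Assoc_RUnit
        LUnit_RUnit)
  have "X \<in> Obj ?G"
    using rangeI[of ev Gen] by simp
  then obtain P where P: "structure_preserving_functor F ?G P" "fst P X = X"
    using free G unfolding free_skew_monoidal_on_object_def by blast
  interpret P: structure_preserving_functor F ?G P by fact
  have P_derivables: "snd P f \<in> derivables" if "f \<in> Arr F" for f
    using PiE_mem[OF P.arr_map that] by simp
  have "fst P A \<in> range ev" if "A \<in> Obj F" for A
    using PiE_mem[OF P.obj_map that] by simp
  \<comment> \<open>The operations of \<open>?G\<close> are those of \<open>F\<close>, so composing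
    with the inclusion does not change \<open>P\<close>.\<close>
  then have "structure_preserving_functor F F P"
    using P.obj_map P.arr_map P.map_Dom P.map_Cod P.map_Ident P.map_Comp P.map_Unit P.map_TensorO
      P.map_TensorA P.map_Assoc P.map_LUnit P.map_RUnit
    by unfold_locales (auto simp: derivables_Arr PiE_iff)
  moreover have "\<exists>!P. structure_preserving_functor F F P \<and> fst P X = X"
    using free F X_Obj by (simp add: free_skew_monoidal_on_object_def)
  moreover have "fst (restrict id (Obj F), restrict id (Arr F)) X = X" by simp
  ultimately have "P = (restrict id (Obj F), restrict id (Arr F))"
    using structure_preserving_functor_id[OF F] P(2) by blast
  then show ?thesis using P_derivables derivables_Arr by auto
qed

lemma countable_Arr_Delta_bot: "countable (Arr Delta_bot)"
proof (rule countable_subset)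
  show "Arr Delta_bot \<subseteq> (\<Union>m. \<Union>n. (\<lambda>\<xi>. (m, n, \<xi>)) ` ({..<m} \<rightarrow>\<^sub>E {..<n}))"
    by (auto simp: Delta_bot_def)
  show "countable (\<Union>m. \<Union>n. (\<lambda>\<xi>. (m, n, \<xi>)) ` ({..<m::nat} \<rightarrow>\<^sub>E {..<n::nat}))"
    by (intro countable_UN countable_image) (auto intro: countable_finite finite_PiE)
qed

theorem corollary11p4:
  fixes F :: "('o::infinite, 'a::infinite) skew_monoidal" and X :: 'o
  assumes "free_skew_monoidal_on_object F X"
  shows "\<exists>!P. structure_preserving_functor F Delta_bot P \<and> faithful F P
           \<and> fst P X = Unit Delta_bot"
proof -
  interpret skew_monoidal_category F
    using assms by (simp add: free_skew_monoidal_on_object_def)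
  interpret pointed_skew_monoidal_category F X
    using assms by unfold_locales (simp add: free_skew_monoidal_on_object_def)
  have pointed: "pointed_skew_monoidal_category F X" by unfold_locales
  have unique: "\<exists>!P. structure_preserving_functor F Delta_bot P \<and> fst P X = Unit Delta_bot"
    by (rule free_skew_monoidal_universal[OF assms skew_monoidal_category_Delta_bot _
          countable_Arr_Delta_bot]) (auto simp: Delta_bot_sel)
  \<comment> \<open>Every functor with the prescribed value at \<open>X\<close> is faithful, so
    requiring faithfulness keeps both existence and uniqueness.\<close>
  moreover have "faithful F P"
    if P: "structure_preserving_functor F Delta_bot P" "fst P X = Unit Delta_bot" for P
  proof -
    interpret structure_preserving_functor F Delta_bot P by fact
    interpret functor_to_Delta_bot F X P
      using P(2) by unfold_locales (simp add: Delta_bot_sel)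
    have "f = g" if "f \<in> hom F S T" "g \<in> hom F S T" "snd P f = snd P g" for S T f g
    proof -
      have f: "f \<in> Arr F" "Dom F f = S" "Cod F f = T" and g: "g \<in> Arr F" "Dom F g = S" "Cod F g = T"
        using that by (auto simp: hom_def)
      then obtain A B A' B' where d: "derivable A B f" "derivable A' B' g"
        using derivables_free[OF assms pointed] by (auto simp: derivables_def)
      then have "A' = A" "B' = B"
        using f g inj_ev_free[OF assms pointed] by (auto dest!: derivable_arr dest: injD)
      with d that(3) show ?thesis
        by (auto intro: derivable_unique simp: und_def)
    qed
    then show ?thesis by (auto simp: faithful_def inj_on_def)
  qed
  ultimately show ?thesis by blast
qed

end
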